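(* Let $f$ and $g$ be as in the context, and let a nonempty set $\mathbb{X}\subset\mathbb{R}^m$ be strongly invariant with respect to the system $\dot x=f(x,a,b)$, $a(t)\in\mathbb{A}$, $b(t)\in\mathbb{B}$. Then, for a function $U_*:\mathbb{X}\to[0,1]$, the following are equivalent: $U_*$ is a limit of $\mathcal{V}_T$ as $T\uparrow\infty$ that is uniform in $\mathbb{X}$; $U_*$ is a limit of $\mathcal{W}_\lambda$ as $\lambda\downarrow0$ that is uniform in $\mathbb{X}$.
   Context: Setting: $\mathbb{R}_+=[0,\infty)$. $\mathbb{A}$ and $\mathbb{B}$ are nonempty compact subsets of finite-dimensional Euclidean spaces. The functions $f:\mathbb{R}^m\times\mathbb{A}\times\mathbb{B}\to\mathbb{R}^m$ and $g:\mathbb{R}^m\times\mathbb{A}\times\mathbb{B}\to[0,1]$ are continuous, and there is a constant $L>0$ with $$\|f(x,a,b)-f(y,a,b)\|+|g(x,a,b)-g(y,a,b)|\le L\|x-y\|\qquad\forall x,y\in\mathbb{R}^m,\ a\in\mathbb{A},\ b\in\mathbb{B}.$$ (No Isaacs condition is assumed.) $B(\mathbb{R}_+,\mathbb{A})$ and $B(\mathbb{R}_+,\mathbb{B})$ denote the sets of all Borel measurable functions $\mathbb{R}_+\to\mathbb{A}$ and $\mathbb{R}_+\to\mathbb{B}$. For $(a,b)\in B(\mathbb{R}_+,\mathbb{A})\times B(\mathbb{R}_+,\mathbb{B})$ and $x_*\in\mathbb{R}^m$, $y(\cdot;x_*,a,b)$ denotes the unique solution on $\mathbb{R}_+$ of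 $\dot x(t)=f(x(t),a(t),b(t))$, $x(0)=x_*$; $Y(x_* )$ is the set of all such solutions (over all $(a,b)$). A set $\mathbb{X}\subset\mathbb{R}^m$ is strongly invariant with respect to the system if $x(t)\in\mathbb{X}$ for all $t\in\mathbb{R}_+$, $x_*\in\mathbb{X}$, $x\in Y(x_* )$. Payoffs: for $T,\lambda>0$, $$v_T(x,a,b)=\frac1T\int_0^T g(x(t),a(t),b(t))\,dt,\qquad w_\lambda(x,a,b)=\lambda\int_0^\infty e^{-\lambda t}g(x(t),a(t),b(t))\,dt,$$ where $x$ is a solution starting in $\mathbb{X}$, $a\in B(\mathbb{R}_+,\mathbb{A})$, $b\in B(\mathbb{R}_+,\mathbb{B})$. A nonanticipating strategy for the first player is a map $\alpha:B(\mathbb{R}_+,\mathbb{B})\to B(\mathbb{R}_+,\mathbb{A})$ such that for all $t>0$ and $b,b'\in B(\mathbb{R}_+,\mathbb{B})$, $b|_{[0,t]}=b'|_{[0,t]}$ implies $\alpha[b]|_{[0,t]}=\alpha[b']|_{[0,t]}$. Let $\mathcal{A}$ be the set of all such strategies. The lower game values are, for $x_*\in\mathbb{X}$, $$\mathcal{V}_T(x_* )=\sup_{\alpha\in\mathcal{A}}\inf_{b\in B(\mathbb{R}_+,\mathbb{B})}v_T\big(y(\cdot;x_*,\alpha[b],b),\alpha[b],b\big),\qquad \mathcal{W}_\lambda(x_* )=\sup_{\alpha\in\mathcal{A}}\inf_{b\in B(\mathbb{R}_+,\mathbb{B})}w_\lambda\big(y(\cdot;x_*,\alpha[b],b),\alpha[b],b\big).$$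 *)

theory Defs
  imports "HOL-Analysis.Analysis"
begin

text \<open>Functions on \<open>[0,\<infinity>)\<close> are extensional functions on the reals (value \<open>undefined\<close> at
  negative times), so that equality of functions on the half-line is HOL equality.\<close>

definition controls :: "'a::topological_space set \<Rightarrow> (real \<Rightarrow> 'a) set" where
  "controls A = borel_measurable (restrict_space borel {0..}) \<inter> ({0..} \<rightarrow>\<^sub>E A)"

text \<open>Controls are merely measurable, so solutions are understood in the sense of Caratheodory,
  that is, as solutions of the integrated equation (with the Lebesgue integral).\<close>

definition is_solution ::
  "('x::euclidean_space \<Rightarrow> 'a \<Rightarrow> 'b \<Rightarrow> 'x) \<Rightarrow> 'x \<Rightarrow> (real \<Rightarrow> 'a) \<Rightarrow> (real \<Rightarrow> 'b) \<Rightarrow> (real \<Rightarrow> 'x) \<Rightarrow> bool"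
where
  "is_solution f x0 a b x \<longleftrightarrow> x \<in> extensional {0..} \<and> continuous_on {0..} x \<and>
    (\<forall>t\<ge>0. set_integrable lborel {0..t} (\<lambda>s. f (x s) (a s) (b s)) \<and>
           x t = x0 + (LINT s:{0..t}|lborel. f (x s) (a s) (b s)))"

definition trajectory ::
  "('x::euclidean_space \<Rightarrow> 'a \<Rightarrow> 'b \<Rightarrow> 'x) \<Rightarrow> 'x \<Rightarrow> (real \<Rightarrow> 'a) \<Rightarrow> (real \<Rightarrow> 'b) \<Rightarrow> real \<Rightarrow> 'x"
where
  "trajectory f x0 a b = (THE x. is_solution f x0 a b x)"

definition trajectories ::
  "('x::euclidean_space \<Rightarrow> 'a::topological_space \<Rightarrow> 'b::topological_space \<Rightarrow> 'x)
    \<Rightarrow> 'a set \<Rightarrow> 'b set \<Rightarrow> 'x \<Rightarrow> (real \<Rightarrow> 'x) set"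
where
  "trajectories f A B x0 = {trajectory f x0 a b | a b. a \<in> controls A \<and> b \<in> controls B}"

definition strongly_invariant ::
  "('x::euclidean_space \<Rightarrow> 'a::topological_space \<Rightarrow> 'b::topological_space \<Rightarrow> 'x)
    \<Rightarrow> 'a set \<Rightarrow> 'b set \<Rightarrow> 'x set \<Rightarrow> bool"
where
  "strongly_invariant f A B X \<longleftrightarrow> (\<forall>x0\<in>X. \<forall>x\<in>trajectories f A B x0. \<forall>t\<ge>0. x t \<in> X)"

definition cesaro_payoff ::
  "('x \<Rightarrow> 'a \<Rightarrow> 'b \<Rightarrow> real) \<Rightarrow> real \<Rightarrow> (real \<Rightarrow> 'x) \<Rightarrow> (real \<Rightarrow> 'a) \<Rightarrow> (real \<Rightarrow> 'b) \<Rightarrow> real"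
where
  "cesaro_payoff g T x a b = (1 / T) * (LINT t:{0..T}|lborel. g (x t) (a t) (b t))"

definition abel_payoff ::
  "('x \<Rightarrow> 'a \<Rightarrow> 'b \<Rightarrow> real) \<Rightarrow> real \<Rightarrow> (real \<Rightarrow> 'x) \<Rightarrow> (real \<Rightarrow> 'a) \<Rightarrow> (real \<Rightarrow> 'b) \<Rightarrow> real"
where
  "abel_payoff g l x a b = l * (LINT t:{0..}|lborel. exp (- l * t) * g (x t) (a t) (b t))"

definition nonanticipating_strategies ::
  "'a::topological_space set \<Rightarrow> 'b::topological_space set \<Rightarrow> ((real \<Rightarrow> 'b) \<Rightarrow> real \<Rightarrow> 'a) set"
where
  "nonanticipating_strategies A B =
    {\<alpha> \<in> controls B \<rightarrow>\<^sub>E controls A.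
      \<forall>t>0. \<forall>b\<in>controls B. \<forall>b'\<in>controls B.
        (\<forall>s\<in>{0..t}. b s = b' s) \<longrightarrow> (\<forall>s\<in>{0..t}. \<alpha> b s = \<alpha> b' s)}"

definition lower_value ::
  "('x::euclidean_space \<Rightarrow> 'a::topological_space \<Rightarrow> 'b::topological_space \<Rightarrow> 'x)
    \<Rightarrow> 'a set \<Rightarrow> 'b set \<Rightarrow> ((real \<Rightarrow> 'x) \<Rightarrow> (real \<Rightarrow> 'a) \<Rightarrow> (real \<Rightarrow> 'b) \<Rightarrow> real) \<Rightarrow> 'x \<Rightarrow> real"
where
  "lower_value f A B c x0 =
    (SUP \<alpha>\<in>nonanticipating_strategies A B. INF b\<in>controls B.
      c (trajectory f x0 (\<alpha> b) b) (\<alpha> b) b)"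

end

theory Submission
  imports Defs
begin

text \<open>Let \<open>P \<mu> \<phi>\<close> denote the value of the game that is stopped at time \<open>h\<close>, with payoff
  \<open>\<mu>\<close> times the mean of \<open>g\<close> on \<open>[0,h]\<close> plus \<open>(1 - \<mu>)\<close> times \<open>\<phi>\<close> of the final state. It is
  a \<open>(1 - \<mu>)\<close>-contraction in \<open>\<phi>\<close>. By dynamic programming, the Cesaro values satisfy
  \<open>V (k h) = P (1/k) (V ((k - 1) h))\<close>, and the Abel value \<open>W l\<close> satisfies \<open>W l = P \<mu> (W l)\<close> up to
  \<open>2 \<mu>\<^sup>2\<close> when \<open>\<mu> = 1 - exp (- l h) \<le> 1/2\<close>.

  If \<open>V \<rightarrow> U\<close>, fix \<open>n\<close>, put \<open>\<mu> = 1/n\<close> and let \<open>h \<rightarrow> \<infinity>\<close>: then \<open>U\<close> is nearly fixed by \<open>P \<mu>\<close>, so that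
  the contraction bounds \<open>\<bar>W l - U\<bar>\<close> by \<open>2 \<mu> + o(1)\<close>. If \<open>W \<rightarrow> U\<close>, then \<open>U\<close> is fixed by \<open>P (1/k)\<close> up to
  \<open>2/k\<^sup>2 + o(1)\<close> for every \<open>2 \<le> k \<le> n\<close>, and iterating the recursion for \<open>V\<close> up to \<open>T = n h\<close> gives
  \<open>n \<bar>V T - U\<bar> \<le> 1 + (\<Sum>k=2..n. 2/k) + o(1)\<close>, whose right-hand side is \<open>o(n)\<close>.\<close>

subsection \<open>Caratheodory solutions\<close>

lemma set_integral_norm_le:
  fixes F :: "'a \<Rightarrow> 'c::{banach, second_countable_topology}" and G :: "'a \<Rightarrow> real"
  assumes "set_integrable M S F" "set_integrable M S G" "\<And>s. s \<in> S \<Longrightarrow> norm (F s) \<le> G s"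
  shows "norm (LINT s:S|M. F s) \<le> (LINT s:S|M. G s)"
proof -
  have "norm (LINT s:S|M. F s) \<le> (LINT s:S|M. norm (F s))"
    by (rule set_integral_norm_bound[OF assms(1)])
  also have "\<dots> \<le> (LINT s:S|M. G s)"
    using set_integrable_norm[OF assms(1)] assms(2,3) by (rule set_integral_mono)
  finally show ?thesis .
qed

text \<open>Cuts an integral at time \<open>h\<close> and restarts the clock there; used for
  trajectories and for both payoffs. A general \<open>S\<close> covers bounded intervals and the
  half-line at once. \<open>F'\<close> is prescribed only at positive times because a joined control
  keeps its first part at the junction.\<close>

lemma set_integral_split_shift:
  fixes F F' :: "real \<Rightarrow> 'c::{banach, second_countable_topology}"
  assumes F: "set_integrable lborel S F"
    and S: "S \<in> sets borel" "{0..h} \<subseteq> S" "S \<subseteq> {0..}"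
    and T: "T = {s. 0 \<le> s \<and> h + s \<in> S}"
    and F': "\<And>s. 0 < s \<Longrightarrow> s \<in> T \<Longrightarrow> F' s = F (h + s)"
    and h: "0 \<le> h"
  shows "set_integrable lborel T F'"
    and "(LINT s:S|lborel. F s) = (LINT s:{0..h}|lborel. F s) + (LINT s:T|lborel. F' s)"
proof -
  let ?S = "S \<inter> {h<..}"
  have int1: "set_integrable lborel {0..h} F"
    by (rule set_integrable_subset[OF F]) (use S in auto)
  have int2: "set_integrable lborel ?S F"
    by (rule set_integrable_subset[OF F]) (use S in auto)
  have S_eq: "S = {0..h} \<union> ?S"
    using S h by auto
  have split: "(LINT s:S|lborel. F s) = (LINT s:{0..h}|lborel. F s) + (LINT s:?S|lborel. F s)"
    by (subst S_eq, rule set_integral_Un) (use int1 int2 in auto)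
  have shift_int: "integrable lborel (\<lambda>s. indicator ?S (h + s) *\<^sub>R F (h + s))"
    using lborel_integrable_real_affine[OF int2[unfolded set_integrable_def], of 1 h] by simp
  have shift: "(LINT s:?S|lborel. F s) = (LINT s|lborel. indicator ?S (h + s) *\<^sub>R F (h + s))"
    using lborel_integral_real_affine[of 1 "\<lambda>s. indicator ?S s *\<^sub>R F s" h]
    by (simp add: set_lebesgue_integral_def)
  \<comment> \<open>At \<open>s = 0\<close> the left side vanishes while \<open>0\<close> lies in
    \<open>T\<close>, so the comparison discards this one point.\<close>
  have eq: "indicator ?S (h + s) *\<^sub>R F (h + s) = indicator T s *\<^sub>R F' s" if "s \<noteq> 0" for s
    using that F'[of s] T S h by (auto simp: indicator_def)
  have "integrable lborel (\<lambda>s. indicator ?S (h + s) *\<^sub>R F (h + s))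
        \<longleftrightarrow> integrable lborel (\<lambda>s. indicator T s *\<^sub>R F' s)"
    by (rule integrable_discrete_difference[where X="{0}"]) (use eq in auto)
  then show "set_integrable lborel T F'"
    using shift_int by (simp add: set_integrable_def)
  have "(LINT s|lborel. indicator ?S (h + s) *\<^sub>R F (h + s)) = (LINT s|lborel. indicator T s *\<^sub>R F' s)"
    by (rule integral_discrete_difference[where X="{0}"]) (use eq in auto)
  then show "(LINT s:S|lborel. F s) = (LINT s:{0..h}|lborel. F s) + (LINT s:T|lborel. F' s)"
    using split shift by (simp add: set_lebesgue_integral_def)
qed

lemma exp_integral:
  fixes K :: real
  assumes "0 \<le> t" "K \<noteq> 0"
  shows "(LINT s:{0..t}|lborel. exp (K * s)) = (exp (K * t) - 1) / K"
proof -
  have "(LINT s:{0..t}|lborel. exp (K * s)) = exp (K * t) / K - exp (K * 0) / K"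
    unfolding set_lebesgue_integral_def
    using assms by (intro integral_FTC_atLeastAtMost)
      (auto intro!: derivative_eq_intros continuous_intros simp: has_real_derivative_iff_has_vector_derivative[symmetric])
  then show ?thesis by (simp add: diff_divide_distrib)
qed

lemma continuous_on_indefinite_set_integral:
  fixes F :: "real \<Rightarrow> 'c::euclidean_space"
  assumes "\<And>t. 0 \<le> t \<Longrightarrow> set_integrable lborel {0..t} F"
  shows "continuous_on {0..} (\<lambda>t. LINT s:{0..t}|lborel. F s)"
  unfolding continuous_on_eq_continuous_within
proof
  fix t :: real assume "t \<in> {0..}"
  then have t: "0 \<le> t" by simp
  have "continuous_on {0..t+1} (\<lambda>t. integral {0..t} F)"
    by (rule indefinite_integral_continuous_1, rule set_borel_integral_eq_integral(1)) (use assms t in auto)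
  then have "continuous_on {0..t+1} (\<lambda>t. LINT s:{0..t}|lborel. F s)"
    by (rule continuous_on_eq) (simp add: set_borel_integral_eq_integral(2)[OF assms])
  then have "continuous (at t within {0..t+1}) (\<lambda>t. LINT s:{0..t}|lborel. F s)"
    using t by (simp add: continuous_on_eq_continuous_within)
  \<comment> \<open>Continuity is local, so the bounded interval, where the theorem on indefinite
    integrals applies, is enough.\<close>
  moreover have "at t within {0..} = at t within {0..t+1}"
    by (rule at_within_nhd[of t "{..<t+1}"]) auto
  ultimately show "continuous (at t within {0..}) (\<lambda>t. LINT s:{0..t}|lborel. F s)"
    by (simp add: continuous_within)
qed

text \<open>Instead of differentiating, look at the maximum \<open>m\<close> of \<open>u\<close>
  weighted by \<open>exp (- (2 * L * t))\<close>. Inserting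
  \<open>u s \<le> exp (2 * L * s) * m\<close> into the integral inequality at the maximiser
  \<open>r\<close> produces the factor \<open>L / (2 * L)\<close>, hence
  \<open>m \<le> m / 2\<close>.\<close>

lemma gronwall_zero:
  fixes u :: "real \<Rightarrow> real"
  assumes u: "continuous_on {0..h} u" "\<And>t. t \<in> {0..h} \<Longrightarrow> 0 \<le> u t" and L: "0 < L" and h: "0 \<le> h"
    and le: "\<And>t. t \<in> {0..h} \<Longrightarrow> u t \<le> (LINT s:{0..t}|lborel. L * u s)"
    and t: "t \<in> {0..h}"
  shows "u t = 0"
proof -
  have "continuous_on {0..h} (\<lambda>t. exp (- (2 * L * t)) * u t)"
    by (intro continuous_intros u)
  then obtain r where r: "r \<in> {0..h}"
      and max: "\<And>t. t \<in> {0..h} \<Longrightarrow> exp (- (2 * L * t)) * u t \<le> exp (- (2 * L * r)) * u r"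
    using continuous_attains_sup[of "{0..h}" "\<lambda>t. exp (- (2 * L * t)) * u t"] h by auto
  define m where "m = exp (- (2 * L * r)) * u r"
  have bound: "u t \<le> exp (2 * L * t) * m" if "t \<in> {0..h}" for t
  proof -
    have "exp (2 * L * t) * (exp (- (2 * L * t)) * u t) \<le> exp (2 * L * t) * m"
      using max[OF that] by (simp add: m_def)
    then show ?thesis by (simp add: mult.assoc[symmetric] exp_add[symmetric])
  qed
  have m0: "0 \<le> m" unfolding m_def using u(2)[OF r] by simp
  have "u r \<le> (LINT s:{0..r}|lborel. L * u s)" using le r by blast
  also have "\<dots> \<le> (LINT s:{0..r}|lborel. exp (2 * L * s) * (L * m))"
    by (rule set_integral_mono)
       (use r L bound in \<open>auto intro!: borel_integrable_atLeastAtMost' continuous_intros continuous_on_subset[OF u(1)] simp: mult.left_commute\<close>)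
  also have "\<dots> = (exp (2 * L * r) - 1) / (2*L) * (L * m)"
    using exp_integral[of r "2*L"] r L by simp
  also have "\<dots> \<le> exp (2 * L * r) * (m / 2)"
    using L m0 by (simp add: field_simps)
  finally have "exp (- (2 * L * r)) * u r \<le> exp (- (2 * L * r)) * (exp (2 * L * r) * (m / 2))"
    by (intro mult_left_mono) auto
  then have "m \<le> m / 2"
    unfolding m_def[symmetric] by (simp add: mult.assoc[symmetric] exp_add[symmetric])
  then have "m = 0" using m0 by linarith
  then show ?thesis using bound[OF t] u(2)[OF t] by simp
qed

lemma controls_measurable: "a \<in> controls A \<Longrightarrow> a \<in> borel_measurable (restrict_space borel {0..})"
  and controls_in: "a \<in> controls A \<Longrightarrow> 0 \<le> t \<Longrightarrow> a t \<in> A"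
  by (auto simp: controls_def)

lemma measurable_along:
  fixes F :: "'x::euclidean_space \<times> 'a::euclidean_space \<times> 'b::euclidean_space \<Rightarrow> 'c::euclidean_space"
  assumes F: "continuous_on (UNIV \<times> A \<times> B) F" and x: "continuous_on {0..} x"
    and a: "a \<in> controls A" and b: "b \<in> controls B"
  shows "(\<lambda>s. F (x s, a s, b s)) \<in> borel_measurable (restrict_space borel {0..})"
proof -
  have "x \<in> borel_measurable (restrict_space borel {0..})"
    by (rule borel_measurable_continuous_on_restrict[OF x])
  then have "(\<lambda>s. (x s, a s, b s)) \<in> borel_measurable (restrict_space borel {0..})"
    by (intro borel_measurable_Pair controls_measurable[OF a] controls_measurable[OF b])
  \<comment> \<open>\<open>F\<close> is known to be continuous only on this product, so the codomain
    is restricted before composing.\<close>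
  then have "(\<lambda>s. (x s, a s, b s)) \<in> measurable (restrict_space borel {0..}) (restrict_space borel (UNIV \<times> A \<times> B))"
    using a b by (intro measurable_restrict_space2) (auto simp: space_restrict_space controls_in)
  then show ?thesis
    by (rule measurable_compose[OF _ borel_measurable_continuous_on_restrict[OF F]])
qed

section \<open>Existence, uniqueness and flow property of trajectories\<close>

locale control_system =
  fixes f :: "'x::euclidean_space \<Rightarrow> 'a::euclidean_space \<Rightarrow> 'b::euclidean_space \<Rightarrow> 'x"
    and A :: "'a set" and B :: "'b set" and L :: real
  assumes compact: "compact A" "compact B" and nonempty: "A \<noteq> {}" "B \<noteq> {}"
    and cont_f: "continuous_on (UNIV \<times> A \<times> B) (\<lambda>(x, a, b). f x a b)"
    and L_pos: "0 < L"
    and lipschitz: "\<And>x y a b. a \<in> A \<Longrightarrow> b \<in> B \<Longrightarrow> norm (f x a b - f y a b) \<le> L * norm (x - y)"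
begin

text \<open>Compactness bounds \<open>f 0 a b\<close> uniformly and the Lipschitz condition adds the
  linear term. The bound dominates the right-hand side along any continuous path and keeps the
  Picard operator among bounded functions.\<close>

lemma linear_growth:
  obtains M where "0 \<le> M" "\<And>x a b. a \<in> A \<Longrightarrow> b \<in> B \<Longrightarrow> norm (f x a b) \<le> M + L * norm x"
proof -
  have "continuous_on ({0} \<times> A \<times> B) (\<lambda>(x, a, b). f x a b)"
    by (rule continuous_on_subset[OF cont_f]) auto
  then have "compact ((\<lambda>(x, a, b). f x a b) ` ({0} \<times> A \<times> B))"
    by (intro compact_continuous_image compact_Times compact) auto
  then obtain M where M: "\<And>y. y \<in> (\<lambda>(x, a, b). f x a b) ` ({0} \<times> A \<times> B) \<Longrightarrow> norm y \<le> M"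
    using compact_imp_bounded bounded_iff by metis
  have "norm (f x a b) \<le> max 0 M + L * norm x" if ab: "a \<in> A" "b \<in> B" for x a b
  proof -
    have "norm (f 0 a b) \<le> M" using M ab by force
    moreover have "norm (f x a b) \<le> norm (f x a b - f 0 a b) + norm (f 0 a b)"
      by (metis diff_add_cancel norm_triangle_ineq)
    moreover have "norm (f x a b - f 0 a b) \<le> L * norm x" using lipschitz[OF ab, of x 0] by simp
    ultimately show ?thesis by linarith
  qed
  then show ?thesis using that[of "max 0 M"] by auto
qed

lemma rhs_integrable:
  assumes x: "continuous_on {0..} x" and a: "a \<in> controls A" and b: "b \<in> controls B"
  shows "set_integrable lborel {0..t} (\<lambda>s. f (x s) (a s) (b s))"
proof -
  obtain M where M: "0 \<le> M" "\<And>x a b. a \<in> A \<Longrightarrow> b \<in> B \<Longrightarrow> norm (f x a b) \<le> M + L * norm x"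
    using linear_growth by blast
  have "(\<lambda>s. f (x s) (a s) (b s)) \<in> borel_measurable (restrict_space borel {0..})"
    using measurable_along[OF cont_f x a b] by simp
  then have "set_borel_measurable lborel {0..} (\<lambda>s. f (x s) (a s) (b s))"
    by (simp add: borel_measurable_restrict_space_iff set_borel_measurable_def)
  then have meas: "set_borel_measurable lborel {0..t} (\<lambda>s. f (x s) (a s) (b s))"
    by (rule set_borel_measurable_subset) auto
  have "set_integrable lborel {0..t} (\<lambda>s. M + L * norm (x s))"
    by (intro borel_integrable_atLeastAtMost' continuous_intros continuous_on_subset[OF x]) auto
  then show ?thesis
    using meas
  proof (rule set_integrable_bound, intro AE_I2 impI)
    fix s assume "s \<in> {0..t}"
    then have "norm (f (x s) (a s) (b s)) \<le> M + L * norm (x s)"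
      by (intro M controls_in[OF a] controls_in[OF b]) auto
    then show "norm (f (x s) (a s) (b s)) \<le> norm (M + L * norm (x s))" by simp
  qed
qed

text \<open>Gronwall for the difference of the two paths. Agreement of the controls is asked only up
  to \<open>h\<close>, so the same lemma also yields causality: the past of a trajectory depends on
  the past of its controls.\<close>

lemma solution_unique:
  assumes x: "is_solution f x0 a b x" and x': "is_solution f x0 a' b' x'"
    and a: "a \<in> controls A" "b \<in> controls B"
    and eq: "\<And>s. 0 \<le> s \<Longrightarrow> s \<le> h \<Longrightarrow> a s = a' s \<and> b s = b' s"
    and t: "0 \<le> t" "t \<le> h"
  shows "x t = x' t"
proof -
  have cx: "continuous_on {0..} x" "continuous_on {0..} x'"
    using x x' by (auto simp: is_solution_def)
  have cxh: "continuous_on {0..h} x" "continuous_on {0..h} x'"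
    by (rule continuous_on_subset[OF cx(1)] continuous_on_subset[OF cx(2)]; auto)+
  have "norm (x t - x' t) = 0"
  proof (rule gronwall_zero[where h=h and L=L and u="\<lambda>t. norm (x t - x' t)"])
    show "continuous_on {0..h} (\<lambda>t. norm (x t - x' t))"
      by (intro continuous_intros cxh)
    fix t assume t: "t \<in> {0..h}"
    let ?F = "\<lambda>s. f (x s) (a s) (b s)" and ?F' = "\<lambda>s. f (x' s) (a s) (b s)"
    have i: "set_integrable lborel {0..t} ?F" "set_integrable lborel {0..t} ?F'"
      by (intro rhs_integrable cx a)+
    have "(LINT s:{0..t}|lborel. f (x' s) (a' s) (b' s)) = (LINT s:{0..t}|lborel. ?F' s)"
      by (rule set_lebesgue_integral_cong) (use eq t in auto)
    then have "x t - x' t = (LINT s:{0..t}|lborel. ?F s) - (LINT s:{0..t}|lborel. ?F' s)"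
      using x x' t by (simp add: is_solution_def)
    also have "\<dots> = (LINT s:{0..t}|lborel. ?F s - ?F' s)"
      by (rule set_integral_diff(2)[OF i, symmetric])
    finally have *: "x t - x' t = (LINT s:{0..t}|lborel. ?F s - ?F' s)" .
    show "norm (x t - x' t) \<le> (LINT s:{0..t}|lborel. L * norm (x s - x' s))"
      unfolding *
    proof (rule set_integral_norm_le)
      show "set_integrable lborel {0..t} (\<lambda>s. ?F s - ?F' s)"
        by (rule set_integral_diff(1)[OF i])
      show "set_integrable lborel {0..t} (\<lambda>s. L * norm (x s - x' s))"
        by (intro borel_integrable_atLeastAtMost' continuous_intros
              continuous_on_subset[OF cx(1)] continuous_on_subset[OF cx(2)]) auto
      fix s assume "s \<in> {0..t}"
      then show "norm (?F s - ?F' s) \<le> L * norm (x s - x' s)"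
        by (intro lipschitz controls_in[OF a(1)] controls_in[OF a(2)]) auto
    qed
  qed (use L_pos t in auto)
  then show ?thesis by simp
qed

text \<open>The integral operator is a contraction for the supremum norm weighted by \<open>exp (- 2 L t)\<close>,
  which gives a global solution in one application of Banach's theorem.\<close>

lemma solution_exists:
  assumes a: "a \<in> controls A" "b \<in> controls B"
  shows "\<exists>x. is_solution f x0 a b x"
proof -
  obtain M where M: "0 \<le> M" "\<And>x a b. a \<in> A \<Longrightarrow> b \<in> B \<Longrightarrow> norm (f x a b) \<le> M + L * norm x"
    using linear_growth by blast
  define K where "K = 2 * L"
  have K: "0 < K" using L_pos by (simp add: K_def)
  \<comment> \<open>The unknown is the rescaled deviation \<open>z\<close> from \<open>x0\<close>;
    its plain supremum norm is the weighted norm of the deviation.\<close>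
  define X where "X z s = x0 + exp (K * s) *\<^sub>R apply_bcontfun z s" for z :: "real \<Rightarrow>\<^sub>C 'x" and s
  define F where "F z s = f (X z s) (a s) (b s)" for z s
  define I where "I z t = (LINT s:{0..t}|lborel. F z s)" for z and t :: real
  have X_cont: "continuous_on S (X z)" for S z
    unfolding X_def by (intro continuous_intros continuous_on_apply_bcontfun)
  have F_int: "set_integrable lborel {0..t} (F z)" for z t
    unfolding F_def by (rule rhs_integrable[OF X_cont a])
  have I_cont: "continuous_on {0..} (I z)" for z
    unfolding I_def by (rule continuous_on_indefinite_set_integral[OF F_int])
  have scale: "exp (- (K * t)) * (exp (K * t) * r) = r" for t r :: real
    by (simp add: mult.assoc[symmetric] exp_add[symmetric])
  have I_bound: "norm (exp (- (K * t)) *\<^sub>R I z t) \<le> (M + L * norm x0 + L * norm z) / K" if t: "0 \<le> t" for z t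
  proof -
    define C where "C = M + L * norm x0 + L * norm z"
    have C: "0 \<le> C" using M L_pos by (simp add: C_def)
    have "norm (I z t) \<le> (LINT s:{0..t}|lborel. exp (K * s) * C)"
      unfolding I_def
    proof (rule set_integral_norm_le[OF F_int])
      show "set_integrable lborel {0..t} (\<lambda>s. exp (K * s) * C)"
        by (intro borel_integrable_atLeastAtMost' continuous_intros)
      fix s assume s: "s \<in> {0..t}"
      have e: "1 \<le> exp (K * s)" using s K by simp
      have "norm (X z s) \<le> norm x0 + exp (K * s) * norm (z s)"
        unfolding X_def using norm_triangle_ineq[of x0 "exp (K * s) *\<^sub>R z s"] by simp
      also have "\<dots> \<le> norm x0 + exp (K * s) * norm z"
        by (simp add: norm_bounded)
      finally have "L * norm (X z s) \<le> L * (norm x0 + exp (K * s) * norm z)"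
        using L_pos by simp
      moreover have "norm (F z s) \<le> M + L * norm (X z s)"
        unfolding F_def using s by (intro M controls_in[OF a(1)] controls_in[OF a(2)]) auto
      ultimately have "norm (F z s) \<le> 1 * (M + L * norm x0) + exp (K * s) * (L * norm z)"
        by (simp add: algebra_simps)
      also have "\<dots> \<le> exp (K * s) * (M + L * norm x0) + exp (K * s) * (L * norm z)"
        using e M L_pos by (intro add_right_mono mult_right_mono) auto
      finally show "norm (F z s) \<le> exp (K * s) * C" by (simp add: C_def algebra_simps)
    qed
    also have "\<dots> = (exp (K * t) - 1) / K * C"
      using exp_integral[OF t, of K] K by simp
    also have "\<dots> \<le> exp (K * t) * (C / K)"
      using K C by (simp add: field_simps)
    finally have "exp (- (K * t)) * norm (I z t) \<le> exp (- (K * t)) * (exp (K * t) * (C / K))"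
      by (intro mult_left_mono) auto
    then show ?thesis unfolding scale C_def by simp
  qed
  \<comment> \<open>Bounded continuous functions live on the whole line, so negative times receive
    the value at time \<open>0\<close>.\<close>
  define G where "G z t = exp (- (K * max 0 t)) *\<^sub>R I z (max 0 t)" for z t
  have "G z \<in> bcontfun" for z
  proof (rule bcontfun_normI)
    have "continuous_on UNIV (\<lambda>t. I z (max 0 t))"
      by (rule continuous_on_compose2[OF I_cont]) (auto intro!: continuous_intros)
    then show "continuous_on UNIV (G z)"
      unfolding G_def by (intro continuous_intros)
    show "norm (G z t) \<le> (M + L * norm x0 + L * norm z) / K" for t
      unfolding G_def by (rule I_bound) simp
  qed
  then have G: "apply_bcontfun (Bcontfun (G z)) = G z" for z
    by (simp add: Bcontfun_inverse)
  have "\<exists>!z. Bcontfun (G z) = z"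
  proof (rule banach_fix_type[of "1/2"], simp, simp, intro allI)
    fix z w :: "real \<Rightarrow>\<^sub>C 'x"
    show "dist (Bcontfun (G z)) (Bcontfun (G w)) \<le> 1 / 2 * dist z w"
    proof (rule dist_bound, unfold G)
      fix t' :: real
      define t where "t = max 0 t'"
      have t: "0 \<le> t" by (simp add: t_def)
      have "norm (I z t - I w t) = norm (LINT s:{0..t}|lborel. F z s - F w s)"
        unfolding I_def by (simp add: set_integral_diff(2)[OF F_int F_int])
      also have "\<dots> \<le> (LINT s:{0..t}|lborel. exp (K * s) * (L * dist z w))"
      proof (rule set_integral_norm_le[OF set_integral_diff(1)[OF F_int F_int]])
        show "set_integrable lborel {0..t} (\<lambda>s. exp (K * s) * (L * dist z w))"
          by (intro borel_integrable_atLeastAtMost' continuous_intros)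
        fix s assume s: "s \<in> {0..t}"
        have "norm (F z s - F w s) \<le> L * norm (X z s - X w s)"
          unfolding F_def using s by (intro lipschitz controls_in[OF a(1)] controls_in[OF a(2)]) auto
        also have "X z s - X w s = exp (K * s) *\<^sub>R (z s - w s)"
          by (simp add: X_def algebra_simps)
        also have "norm \<dots> = exp (K * s) * dist (z s) (w s)"
          by (simp add: dist_norm)
        also have "L * \<dots> \<le> L * (exp (K * s) * dist z w)"
          using L_pos dist_bounded[of z s w] by simp
        finally show "norm (F z s - F w s) \<le> exp (K * s) * (L * dist z w)"
          by (simp add: algebra_simps)
      qed
      also have "\<dots> = (exp (K * t) - 1) / K * (L * dist z w)"
        using exp_integral[OF t, of K] K by simp
      \<comment> \<open>The choice \<open>K = 2 * L\<close> makes the contraction factor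
        \<open>L / K\<close> equal to \<open>1 / 2\<close>.\<close>
      also have "\<dots> = (exp (K * t) - 1) * (1 / 2 * dist z w)"
        using K L_pos by (simp add: K_def)
      also have "\<dots> \<le> exp (K * t) * (1 / 2 * dist z w)"
        by (intro mult_right_mono) auto
      finally have "exp (- (K * t)) * norm (I z t - I w t) \<le> exp (- (K * t)) * (exp (K * t) * (1 / 2 * dist z w))"
        by simp
      then show "dist (G z t') (G w t') \<le> 1 / 2 * dist z w"
        unfolding scale G_def t_def[symmetric] by (simp add: dist_norm scaleR_diff_right[symmetric])
    qed
  qed
  then obtain z where "Bcontfun (G z) = z" by blast
  then have z: "apply_bcontfun z = G z" using G by metis
  have fixed: "X z t = x0 + I z t" if "0 \<le> t" for t
  proof -
    have "X z t = x0 + exp (K * t) *\<^sub>R G z t" by (simp only: X_def z)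
    also have "\<dots> = x0 + I z t" using that by (simp add: G_def exp_add[symmetric])
    finally show ?thesis .
  qed
  have "is_solution f x0 a b (restrict (X z) {0..})"
    unfolding is_solution_def
  proof (intro conjI allI impI)
    show "continuous_on {0..} (restrict (X z) {0..})"
      using X_cont[of "{0..}" z] by (rule continuous_on_eq) auto
    fix t :: real assume t: "0 \<le> t"
    have "set_integrable lborel {0..t} (\<lambda>s. f (restrict (X z) {0..} s) (a s) (b s)) = set_integrable lborel {0..t} (F z)"
      by (rule set_integrable_cong) (auto simp: F_def)
    then show "set_integrable lborel {0..t} (\<lambda>s. f (restrict (X z) {0..} s) (a s) (b s))"
      using F_int by simp
    have "I z t = (LINT s:{0..t}|lborel. f (restrict (X z) {0..} s) (a s) (b s))"
      unfolding I_def by (rule set_lebesgue_integral_cong) (auto simp: F_def)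
    then show "restrict (X z) {0..} t = x0 + (LINT s:{0..t}|lborel. f (restrict (X z) {0..} s) (a s) (b s))"
      using fixed[OF t] t by simp
  qed auto
  then show ?thesis by blast
qed

text \<open>Solutions are extensional, so agreement at nonnegative times is full equality; this is
  what the description operator in \<open>trajectory\<close> requires.\<close>

lemma solution_eqI:
  assumes "a \<in> controls A" "b \<in> controls B" "is_solution f x0 a b x" "is_solution f x0 a b y"
  shows "x = y"
proof (rule extensionalityI)
  show "x \<in> extensional {0..}" "y \<in> extensional {0..}"
    using assms by (auto simp: is_solution_def)
  show "x t = y t" if "t \<in> {0..}" for t
    using solution_unique[OF assms(3,4,1,2), of t t] that by auto
qed

lemma is_solution_trajectory:
  assumes "a \<in> controls A" "b \<in> controls B"
  shows "is_solution f x0 a b (trajectory f x0 a b)"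
  unfolding trajectory_def
  using solution_exists[OF assms] solution_eqI[OF assms] by (metis theI')

lemma trajectory_eqI:
  assumes "a \<in> controls A" "b \<in> controls B" "is_solution f x0 a b x"
  shows "trajectory f x0 a b = x"
  using solution_eqI[OF assms(1,2) is_solution_trajectory[OF assms(1,2)] assms(3)] .

lemma continuous_on_trajectory:
  "a \<in> controls A \<Longrightarrow> b \<in> controls B \<Longrightarrow> continuous_on {0..} (trajectory f x0 a b)"
  using is_solution_trajectory by (auto simp: is_solution_def)

lemma trajectory_cong:
  assumes "a \<in> controls A" "b \<in> controls B" "a' \<in> controls A" "b' \<in> controls B"
    and "\<And>s. 0 \<le> s \<Longrightarrow> s \<le> h \<Longrightarrow> a s = a' s \<and> b s = b' s" "0 \<le> t" "t \<le> h"
  shows "trajectory f x0 a b t = trajectory f x0 a' b' t"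
  using solution_unique[OF is_solution_trajectory is_solution_trajectory assms(1,2,5-7)] assms(1-4) by blast

text \<open>The semigroup property of the flow: the shifted path solves the shifted integral
  equation, and uniqueness identifies it. A change of the controls at the single time
  \<open>0\<close> does not affect the integrals.\<close>

lemma trajectory_shift:
  assumes a: "a \<in> controls A" "b \<in> controls B" and a': "a' \<in> controls A" "b' \<in> controls B"
    and eq: "\<And>s. 0 < s \<Longrightarrow> a' s = a (h + s) \<and> b' s = b (h + s)"
    and h: "0 \<le> h" and t: "0 \<le> t"
  shows "trajectory f (trajectory f x0 a b h) a' b' t = trajectory f x0 a b (h + t)"
proof -
  define x where "x = trajectory f x0 a b"
  define y where "y = restrict (\<lambda>s. x (h + s)) {0..}"
  have sol: "is_solution f x0 a b x"
    unfolding x_def by (rule is_solution_trajectory[OF a])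
  have "is_solution f (x h) a' b' y"
    unfolding is_solution_def
  proof (intro conjI allI impI)
    show "y \<in> extensional {0..}" by (simp add: y_def)
    have "continuous_on {0..} (\<lambda>s. x (h + s))"
      by (rule continuous_on_compose2[of "{0..}" x])
         (use sol h in \<open>auto intro!: continuous_intros simp: is_solution_def\<close>)
    then show "continuous_on {0..} y"
      by (rule continuous_on_eq) (auto simp: y_def)
    fix t :: real assume t: "0 \<le> t"
    have "set_integrable lborel {0..h+t} (\<lambda>s. f (x s) (a s) (b s))"
      using sol h t by (simp add: is_solution_def)
    note split = set_integral_split_shift[OF this, where h=h and T="{0..t}" and F'="\<lambda>s. f (y s) (a' s) (b' s)"]
    show "set_integrable lborel {0..t} (\<lambda>s. f (y s) (a' s) (b' s))"
      by (rule split(1)) (use h t eq in \<open>auto simp: y_def\<close>)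
    have "(LINT s:{0..h+t}|lborel. f (x s) (a s) (b s)) = (LINT s:{0..h}|lborel. f (x s) (a s) (b s))
        + (LINT s:{0..t}|lborel. f (y s) (a' s) (b' s))"
      by (rule split(2)) (use h t eq in \<open>auto simp: y_def\<close>)
    then show "y t = x h + (LINT s:{0..t}|lborel. f (y s) (a' s) (b' s))"
      using sol h t by (simp add: is_solution_def y_def)
  qed
  then have "trajectory f (x h) a' b' = y"
    by (rule trajectory_eqI[OF a'])
  then show ?thesis using t by (simp add: x_def y_def)
qed

end

subsection \<open>Dynamic programming\<close>

text \<open>The switching time \<open>h\<close> itself belongs to the first control: nonanticipation gives nothing
  on \<open>{0}\<close>, so a strategy restarted at \<open>h\<close> may use the future of \<open>b\<close> in its value at \<open>h\<close>.\<close>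

definition join :: "real \<Rightarrow> (real \<Rightarrow> 'a) \<Rightarrow> (real \<Rightarrow> 'a) \<Rightarrow> real \<Rightarrow> 'a" where
  "join h a a' = (\<lambda>t\<in>{0..}. if t \<le> h then a t else a' (t - h))"

definition shift :: "real \<Rightarrow> (real \<Rightarrow> 'a) \<Rightarrow> real \<Rightarrow> 'a" where
  "shift h a = (\<lambda>t\<in>{0..}. a (h + t))"

text \<open>Extension by zero moves measurability to the whole line, where joins and translates are
  compositions of Borel maps.\<close>

lemma controls_iff:
  fixes A :: "'a::euclidean_space set"
  shows "a \<in> controls A \<longleftrightarrow>
    (\<lambda>t. indicator {0..} t *\<^sub>R a t) \<in> borel_measurable borel \<and> a \<in> {0..} \<rightarrow>\<^sub>E A"
  by (simp add: controls_def borel_measurable_restrict_space_iff)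

lemma const_controls: "a0 \<in> A \<Longrightarrow> (\<lambda>t\<in>{0..}. a0) \<in> controls (A :: 'a::euclidean_space set)"
proof -
  assume a0: "a0 \<in> A"
  have "(\<lambda>t::real. indicator {0..} t *\<^sub>R (\<lambda>t\<in>{0..}. a0) t) = (\<lambda>t. indicator {0..} t *\<^sub>R a0)"
    by (auto simp: indicator_def)
  then show ?thesis using a0 by (auto simp: controls_iff)
qed

lemma join_controls:
  fixes A :: "'a::euclidean_space set"
  assumes "0 \<le> h" "a \<in> controls A" "a' \<in> controls A"
  shows "join h a a' \<in> controls A"
proof -
  define u where "u = (\<lambda>t. indicator {0..} t *\<^sub>R a t)"
  define u' where "u' = (\<lambda>t. indicator {0..} t *\<^sub>R a' t)"
  have [measurable]: "u \<in> borel_measurable borel" "u' \<in> borel_measurable borel"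
    using assms by (simp_all add: controls_iff u_def u'_def)
  have "(\<lambda>t. indicator {0..} t *\<^sub>R join h a a' t) = (\<lambda>t. indicator {..h} t *\<^sub>R u t + indicator {h<..} t *\<^sub>R u' (t - h))"
    using assms(1) by (auto simp: join_def indicator_def u_def u'_def)
  also have "\<dots> \<in> borel_measurable borel" by measurable
  finally have "(\<lambda>t. indicator {0..} t *\<^sub>R join h a a' t) \<in> borel_measurable borel" .
  moreover have "join h a a' \<in> {0..} \<rightarrow>\<^sub>E A"
    using assms by (simp add: join_def PiE_iff controls_in)
  ultimately show ?thesis by (simp only: controls_iff)
qed

lemma shift_controls:
  fixes A :: "'a::euclidean_space set"
  assumes "0 \<le> h" "a \<in> controls A"
  shows "shift h a \<in> controls A"
proof -
  define u where "u = (\<lambda>t. indicator {0..} t *\<^sub>R a t)"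
  have [measurable]: "u \<in> borel_measurable borel"
    using assms by (simp add: controls_iff u_def)
  have "(\<lambda>t. indicator {0..} t *\<^sub>R shift h a t) = (\<lambda>t. indicator {0..} t *\<^sub>R u (h + t))"
    using assms(1) by (auto simp: shift_def indicator_def u_def)
  also have "\<dots> \<in> borel_measurable borel" by measurable
  finally have "(\<lambda>t. indicator {0..} t *\<^sub>R shift h a t) \<in> borel_measurable borel" .
  moreover have "shift h a \<in> {0..} \<rightarrow>\<^sub>E A"
    using assms by (simp add: shift_def PiE_iff controls_in)
  ultimately show ?thesis by (simp only: controls_iff)
qed

lemma strategy_controls: "\<alpha> \<in> nonanticipating_strategies A B \<Longrightarrow> b \<in> controls B \<Longrightarrow> \<alpha> b \<in> controls A"
  by (auto simp: nonanticipating_strategies_def)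

lemma strategy_cong:
  assumes "\<alpha> \<in> nonanticipating_strategies A B" "b \<in> controls B" "b' \<in> controls B" "0 < t"
    and "\<And>s. 0 \<le> s \<Longrightarrow> s \<le> t \<Longrightarrow> b s = b' s" "0 \<le> s" "s \<le> t"
  shows "\<alpha> b s = \<alpha> b' s"
proof -
  have "\<forall>t>0. \<forall>b\<in>controls B. \<forall>b'\<in>controls B. (\<forall>s\<in>{0..t}. b s = b' s) \<longrightarrow> (\<forall>s\<in>{0..t}. \<alpha> b s = \<alpha> b' s)"
    using assms(1) unfolding nonanticipating_strategies_def mem_Collect_eq by (rule conjunct2)
  from this[rule_format, OF assms(4,2,3), of s] show ?thesis
    using assms(5-7) by simp
qed

section \<open>Lower values: bounds, nearly optimal play, comparison\<close>

context control_system
begin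

abbreviation strategies where "strategies \<equiv> nonanticipating_strategies A B"
abbreviation val where "val \<equiv> lower_value f A B"

definition play :: "((real \<Rightarrow> 'x) \<Rightarrow> (real \<Rightarrow> 'a) \<Rightarrow> (real \<Rightarrow> 'b) \<Rightarrow> real) \<Rightarrow> 'x \<Rightarrow> (real \<Rightarrow> 'a) \<Rightarrow> (real \<Rightarrow> 'b) \<Rightarrow> real"
  where "play c x0 a b = c (trajectory f x0 a b) a b"

text \<open>The reals are only conditionally complete; this bound along all plays gives the
  \<open>SUP\<close> and \<open>INF\<close> in the value their meaning.\<close>

definition payoff_bounded :: "((real \<Rightarrow> 'x) \<Rightarrow> (real \<Rightarrow> 'a) \<Rightarrow> (real \<Rightarrow> 'b) \<Rightarrow> real) \<Rightarrow> 'x \<Rightarrow> real \<Rightarrow> bool"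
  where "payoff_bounded c x0 M \<longleftrightarrow> (\<forall>a\<in>controls A. \<forall>b\<in>controls B. \<bar>play c x0 a b\<bar> \<le> M)"

lemma val_eq: "val c x0 = (SUP \<alpha>\<in>strategies. INF b\<in>controls B. play c x0 (\<alpha> b) b)"
  by (simp add: lower_value_def play_def)

lemma payoff_boundedI:
  "(\<And>a b. a \<in> controls A \<Longrightarrow> b \<in> controls B \<Longrightarrow> \<bar>play c x0 a b\<bar> \<le> M) \<Longrightarrow> payoff_bounded c x0 M"
  by (simp add: payoff_bounded_def)

lemma payoff_boundedD:
  "payoff_bounded c x0 M \<Longrightarrow> a \<in> controls A \<Longrightarrow> b \<in> controls B \<Longrightarrow> \<bar>play c x0 a b\<bar> \<le> M"
  by (simp add: payoff_bounded_def)

lemma controls_nonempty: "controls A \<noteq> {}" "controls B \<noteq> {}"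
  using nonempty const_controls[of _ A] const_controls[of _ B] by blast+

lemma strategies_nonempty: "strategies \<noteq> {}"
proof -
  obtain a where "a \<in> controls A" using controls_nonempty by blast
  then have "(\<lambda>b\<in>controls B. a) \<in> strategies"
    by (auto simp: nonanticipating_strategies_def)
  then show ?thesis by blast
qed

lemma play_bdd_below:
  assumes "payoff_bounded c x0 M" "\<alpha> \<in> strategies"
  shows "bdd_below ((\<lambda>b. play c x0 (\<alpha> b) b) ` controls B)"
proof (rule bdd_belowI2)
  show "- M \<le> play c x0 (\<alpha> b) b" if "b \<in> controls B" for b
    using payoff_boundedD[OF assms(1) strategy_controls[OF assms(2) that] that] by linarith
qed

lemma guaranteed_bdd_above:
  assumes "payoff_bounded c x0 M"
  shows "bdd_above ((\<lambda>\<alpha>. INF b\<in>controls B. play c x0 (\<alpha> b) b) ` strategies)"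
proof (rule bdd_aboveI2)
  fix \<alpha> assume \<alpha>: "\<alpha> \<in> strategies"
  obtain b where b: "b \<in> controls B" using controls_nonempty by blast
  have "(INF b\<in>controls B. play c x0 (\<alpha> b) b) \<le> play c x0 (\<alpha> b) b"
    by (rule cINF_lower[OF play_bdd_below[OF assms \<alpha>] b])
  also have "\<dots> \<le> M"
    using payoff_boundedD[OF assms strategy_controls[OF \<alpha> b] b] by linarith
  finally show "(INF b\<in>controls B. play c x0 (\<alpha> b) b) \<le> M" .
qed

lemma val_leI:
  assumes "payoff_bounded c x0 M"
    and "\<And>\<alpha>. \<alpha> \<in> strategies \<Longrightarrow> \<exists>b\<in>controls B. play c x0 (\<alpha> b) b \<le> v"
  shows "val c x0 \<le> v"
  unfolding val_eq
proof (rule cSUP_least[OF strategies_nonempty])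
  fix \<alpha> assume \<alpha>: "\<alpha> \<in> strategies"
  then obtain b where "b \<in> controls B" "play c x0 (\<alpha> b) b \<le> v" using assms(2) by blast
  then show "(INF b\<in>controls B. play c x0 (\<alpha> b) b) \<le> v"
    by (intro cINF_lower2[OF play_bdd_below[OF assms(1) \<alpha>]])
qed

lemma val_geI:
  assumes "payoff_bounded c x0 M"
    and "\<alpha> \<in> strategies" "\<And>b. b \<in> controls B \<Longrightarrow> v \<le> play c x0 (\<alpha> b) b"
  shows "v \<le> val c x0"
  unfolding val_eq
proof (rule cSUP_upper2[OF guaranteed_bdd_above[OF assms(1)] assms(2)])
  show "v \<le> (INF b\<in>controls B. play c x0 (\<alpha> b) b)"
    by (rule cINF_greatest[OF controls_nonempty(2)]) (rule assms(3))
qed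

text \<open>Otherwise every strategy would have a reply below \<open>val c x0 - e\<close>, and
  \<open>val_leI\<close> would bound the value by that number. The slack \<open>e\<close> is there
  because the supremum need not be attained.\<close>

lemma val_strategy:
  assumes bnd: "payoff_bounded c x0 M" and e: "0 < e"
  obtains \<alpha> where "\<alpha> \<in> strategies" "\<And>b. b \<in> controls B \<Longrightarrow> val c x0 - e \<le> play c x0 (\<alpha> b) b"
proof (rule ccontr)
  assume *: "\<not> thesis"
  have "val c x0 \<le> val c x0 - e"
  proof (rule val_leI[OF bnd])
    fix \<alpha> assume "\<alpha> \<in> strategies"
    then show "\<exists>b\<in>controls B. play c x0 (\<alpha> b) b \<le> val c x0 - e"
      using * that[of \<alpha>] by (metis linear)
  qed
  then show False using e by simp
qed

text \<open>Otherwise \<open>\<alpha>\<close> would guarantee \<open>val c x0 + e\<close>, more than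
  the value. Again the slack is there because the infimum need not be attained.\<close>

lemma val_response:
  assumes bnd: "payoff_bounded c x0 M" and e: "0 < e"
    and \<alpha>: "\<alpha> \<in> strategies"
  obtains b where "b \<in> controls B" "play c x0 (\<alpha> b) b \<le> val c x0 + e"
proof (rule ccontr)
  assume *: "\<not> thesis"
  have "val c x0 + e \<le> val c x0"
  proof (rule val_geI[OF bnd \<alpha>])
    fix b assume "b \<in> controls B"
    then show "val c x0 + e \<le> play c x0 (\<alpha> b) b"
      using * that[of b] by (metis linear)
  qed
  then show False using e by simp
qed

lemma val_between:
  assumes "\<And>a b. a \<in> controls A \<Longrightarrow> b \<in> controls B \<Longrightarrow> m \<le> play c x0 a b \<and> play c x0 a b \<le> M"
  shows "m \<le> val c x0" "val c x0 \<le> M"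
proof -
  have bnd: "payoff_bounded c x0 (\<bar>m\<bar> + \<bar>M\<bar>)"
  proof (rule payoff_boundedI)
    show "\<bar>play c x0 a b\<bar> \<le> \<bar>m\<bar> + \<bar>M\<bar>" if "a \<in> controls A" "b \<in> controls B" for a b
      using assms[OF that] by linarith
  qed
  obtain \<alpha> where \<alpha>: "\<alpha> \<in> strategies" using strategies_nonempty by blast
  show "m \<le> val c x0"
    by (rule val_geI[OF bnd \<alpha>]) (simp add: assms strategy_controls[OF \<alpha>])
  obtain b where b: "b \<in> controls B" using controls_nonempty by blast
  show "val c x0 \<le> M"
    by (rule val_leI[OF bnd], rule bexI[OF _ b]) (simp add: assms strategy_controls b)
qed

text \<open>Both games have the same strategies, so a nearly optimal reply to
  \<open>\<alpha>\<close> under \<open>c'\<close> can be reused under \<open>c\<close>.\<close>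

lemma val_le_add:
  assumes bnd: "payoff_bounded c x0 M"
    and bnd': "payoff_bounded c' x0 M'"
    and le: "\<And>a b. a \<in> controls A \<Longrightarrow> b \<in> controls B \<Longrightarrow> play c x0 a b \<le> play c' x0 a b + e"
  shows "val c x0 \<le> val c' x0 + e"
proof (rule field_le_epsilon)
  fix \<delta> :: real assume \<delta>: "0 < \<delta>"
  show "val c x0 \<le> val c' x0 + e + \<delta>"
  proof (rule val_leI[OF bnd])
    fix \<alpha> assume \<alpha>: "\<alpha> \<in> strategies"
    obtain b where b: "b \<in> controls B" "play c' x0 (\<alpha> b) b \<le> val c' x0 + \<delta>"
      using val_response[OF bnd' \<delta> \<alpha>] by blast
    then have "play c x0 (\<alpha> b) b \<le> val c' x0 + e + \<delta>"
      using le[OF strategy_controls[OF \<alpha> b(1)] b(1)] by linarith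
    then show "\<exists>b\<in>controls B. play c x0 (\<alpha> b) b \<le> val c' x0 + e + \<delta>"
      using b(1) by blast
  qed
qed

text \<open>The value is nonexpansive in the payoff. This yields both the contraction in the
  terminal payoff and the cost of replacing discounted weights by uniform ones.\<close>

lemma val_close:
  assumes bnd: "payoff_bounded c x0 M"
    and bnd': "payoff_bounded c' x0 M'"
    and le: "\<And>a b. a \<in> controls A \<Longrightarrow> b \<in> controls B \<Longrightarrow> \<bar>play c x0 a b - play c' x0 a b\<bar> \<le> e"
  shows "\<bar>val c x0 - val c' x0\<bar> \<le> e"
proof -
  have "play c x0 a b \<le> play c' x0 a b + e \<and> play c' x0 a b \<le> play c x0 a b + e"
    if "a \<in> controls A" "b \<in> controls B" for a b
    using le[OF that] by linarith
  then have "val c x0 \<le> val c' x0 + e" "val c' x0 \<le> val c x0 + e"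
    by (simp_all add: val_le_add[OF bnd bnd'] val_le_add[OF bnd' bnd])
  then show ?thesis by linarith
qed

text \<open>The hypothesis on shifted controls leaves out time \<open>0\<close>, where joined controls still carry
  the value of the first one.\<close>

lemma dynamic_programming:
  assumes h: "0 < h" and k: "0 \<le> k" "k \<le> 1"
    and local: "\<And>x a b x' a' b'. (\<And>s. 0 \<le> s \<Longrightarrow> s \<le> h \<Longrightarrow> x s = x' s \<and> a s = a' s \<and> b s = b' s)
      \<Longrightarrow> r x a b = r x' a' b'"
    and split: "\<And>a b a' b'. a \<in> controls A \<Longrightarrow> b \<in> controls B \<Longrightarrow> a' \<in> controls A \<Longrightarrow> b' \<in> controls B
      \<Longrightarrow> (\<And>s. 0 < s \<Longrightarrow> a' s = a (h + s) \<and> b' s = b (h + s))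
      \<Longrightarrow> play c x0 a b = play r x0 a b + k * play c' (trajectory f x0 a b h) a' b'"
    and bnd_r: "payoff_bounded r x0 M"
    and bnd_c': "\<And>z. payoff_bounded c' z M'"
  shows "val c x0 = val (\<lambda>x a b. r x a b + k * val c' (x h)) x0"
proof -
  let ?q = "\<lambda>x a b. r x a b + k * val c' (x h)"
  have h0: "0 \<le> h" using h by simp
  have k_mult: "\<bar>k * v\<bar> \<le> M'" if "\<bar>v\<bar> \<le> M'" for v
  proof -
    have "\<bar>k * v\<bar> \<le> 1 * \<bar>v\<bar>" unfolding abs_mult using k by (intro mult_right_mono) auto
    then show ?thesis using that by simp
  qed
  have bnd_c: "payoff_bounded c x0 (M + M')"
  proof (rule payoff_boundedI)
    fix a b assume ab: "a \<in> controls A" "b \<in> controls B"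
    have sh: "shift h a \<in> controls A" "shift h b \<in> controls B"
      using ab by (auto intro!: shift_controls h0)
    have "play c x0 a b = play r x0 a b + k * play c' (trajectory f x0 a b h) (shift h a) (shift h b)"
      by (rule split[OF ab sh]) (auto simp: shift_def)
    moreover have "\<bar>k * play c' (trajectory f x0 a b h) (shift h a) (shift h b)\<bar> \<le> M'"
      by (rule k_mult[OF payoff_boundedD[OF bnd_c' sh]])
    ultimately show "\<bar>play c x0 a b\<bar> \<le> M + M'" using payoff_boundedD[OF bnd_r ab] by linarith
  qed
  have bnd_val: "\<bar>val c' z\<bar> \<le> M'" for z
  proof -
    have "- M' \<le> play c' z a b \<and> play c' z a b \<le> M'" if "a \<in> controls A" "b \<in> controls B" for a b
      using payoff_boundedD[OF bnd_c' that, of z] by linarith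
    from val_between[OF this] show ?thesis by linarith
  qed
  have play_q: "play ?q x0 a b = play r x0 a b + k * val c' (trajectory f x0 a b h)" for a b
    by (simp add: play_def)
  have bnd_q: "payoff_bounded ?q x0 (M + M')"
  proof (rule payoff_boundedI)
    show "\<bar>play ?q x0 a b\<bar> \<le> M + M'" if ab: "a \<in> controls A" "b \<in> controls B" for a b
      using payoff_boundedD[OF bnd_r ab] k_mult[OF bnd_val[of "trajectory f x0 a b h"]]
      unfolding play_q by linarith
  qed
  \<comment> \<open>Since \<open>k \<le> 1\<close>, slack in the continuation game is not
    amplified.\<close>
  have k_e: "k * (v + e) \<le> k * v + e \<and> k * v - e \<le> k * (v - e)" if "0 < e" for v e
    using mult_right_mono[of k 1 e] k that by (simp add: algebra_simps)
  show ?thesis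
  proof (rule antisym; rule field_le_epsilon)
    fix e :: real assume e: "0 < e"
    show "val c x0 \<le> val ?q x0 + e"
    proof (rule val_leI[OF bnd_c])
      fix \<alpha> assume \<alpha>: "\<alpha> \<in> strategies"
      have e2: "0 < e / 2" using e by simp
      obtain b where b: "b \<in> controls B" and b_le: "play ?q x0 (\<alpha> b) b \<le> val ?q x0 + e / 2"
        using val_response[OF bnd_q e2 \<alpha>] by blast
      \<comment> \<open>\<open>\<beta>\<close> is what \<open>\<alpha>\<close> becomes after
        \<open>h\<close> once \<open>b\<close> has been played. The second player will join
        \<open>b\<close> with a nearly optimal reply to \<open>\<beta>\<close>.\<close>
      define \<beta> where "\<beta> = (\<lambda>b'\<in>controls B. shift h (\<alpha> (join h b b')))"
      have j: "join h b b' \<in> controls B" if "b' \<in> controls B" for b'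
        by (rule join_controls[OF h0 b that])
      have \<beta>: "\<beta> \<in> strategies"
        unfolding nonanticipating_strategies_def
      proof (intro CollectI conjI allI impI ballI)
        show "\<beta> \<in> controls B \<rightarrow>\<^sub>E controls A"
          by (auto simp: \<beta>_def intro!: shift_controls h0 strategy_controls[OF \<alpha>] j)
        fix t b1 b2 s
        assume t: "0 < t" and b12: "b1 \<in> controls B" "b2 \<in> controls B" "\<forall>s\<in>{0..t}. b1 s = b2 s"
          and s: "s \<in> {0..t}"
        have "\<alpha> (join h b b1) (h + s) = \<alpha> (join h b b2) (h + s)"
          by (rule strategy_cong[OF \<alpha> j j, where t="h + t"])
             (use h t b12 s in \<open>auto simp: join_def\<close>)
        then show "\<beta> b1 s = \<beta> b2 s"
          using s b12 by (simp add: \<beta>_def shift_def)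
      qed
      define z where "z = trajectory f x0 (\<alpha> b) b h"
      obtain b' where b': "b' \<in> controls B" and b'_le: "play c' z (\<beta> b') b' \<le> val c' z + e / 2"
        using val_response[OF bnd_c'[of z] e2 \<beta>] by blast
      let ?b = "join h b b'"
      \<comment> \<open>The join keeps \<open>b\<close> up to and including \<open>h\<close>, so by
        nonanticipation \<open>\<alpha>\<close> does not see \<open>b'\<close> before the
        switch.\<close>
      have eq: "\<alpha> ?b s = \<alpha> b s \<and> ?b s = b s" if "0 \<le> s" "s \<le> h" for s
        using strategy_cong[OF \<alpha> j[OF b'] b h, of s] that by (auto simp: join_def)
      have traj: "trajectory f x0 (\<alpha> ?b) ?b s = trajectory f x0 (\<alpha> b) b s" if "0 \<le> s" "s \<le> h" for s
        by (rule trajectory_cong[where h=h]) (use that eq in \<open>auto intro!: strategy_controls[OF \<alpha>] j b b'\<close>)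
      have "play c x0 (\<alpha> ?b) ?b = play r x0 (\<alpha> ?b) ?b + k * play c' (trajectory f x0 (\<alpha> ?b) ?b h) (\<beta> b') b'"
      proof (rule split)
        show "\<beta> b' s = \<alpha> ?b (h + s) \<and> b' s = ?b (h + s)" if "0 < s" for s
          using that h b' by (auto simp: \<beta>_def shift_def join_def)
      qed (auto intro!: strategy_controls[OF \<alpha>] strategy_controls[OF \<beta>] j b')
      also have "trajectory f x0 (\<alpha> ?b) ?b h = z"
        using traj[of h] h by (simp add: z_def)
      also have "play r x0 (\<alpha> ?b) ?b = play r x0 (\<alpha> b) b"
        unfolding play_def by (rule local) (simp add: traj eq)
      also have "play r x0 (\<alpha> b) b + k * play c' z (\<beta> b') b' \<le> play r x0 (\<alpha> b) b + k * (val c' z + e / 2)"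
        using b'_le k by (intro add_left_mono mult_left_mono) auto
      also have "\<dots> \<le> play ?q x0 (\<alpha> b) b + e / 2"
        using k_e[OF e2, of "val c' z"] by (simp add: z_def play_q)
      also have "\<dots> \<le> val ?q x0 + e"
        using b_le by simp
      finally show "\<exists>b\<in>controls B. play c x0 (\<alpha> b) b \<le> val ?q x0 + e"
        using j[OF b'] by blast
    qed
  next
    fix e :: real assume e: "0 < e"
    then have e2: "0 < e / 2" by simp
    obtain \<alpha> where \<alpha>: "\<alpha> \<in> strategies" and \<alpha>_ge: "\<And>b. b \<in> controls B \<Longrightarrow> val ?q x0 - e / 2 \<le> play ?q x0 (\<alpha> b) b"
      using val_strategy[OF bnd_q e2] by blast
    \<comment> \<open>A nearly optimal strategy is chosen for every state; the first player follows
      \<open>\<alpha>\<close> up to \<open>h\<close> and then starts the one belonging to the state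
      reached.\<close>
    have "\<exists>\<sigma>. \<sigma> \<in> strategies \<and> (\<forall>b\<in>controls B. val c' z - e / 2 \<le> play c' z (\<sigma> b) b)" for z
      using val_strategy[OF bnd_c'[of z] e2] by metis
    then obtain \<sigma> where \<sigma>: "\<And>z. \<sigma> z \<in> strategies"
      and \<sigma>_ge: "\<And>z b. b \<in> controls B \<Longrightarrow> val c' z - e / 2 \<le> play c' z (\<sigma> z b) b"
      by metis
    define z where "z b = trajectory f x0 (\<alpha> b) b h" for b
    define \<beta> where "\<beta> = (\<lambda>b\<in>controls B. join h (\<alpha> b) (\<sigma> (z b) (shift h b)))"
    have \<beta>_eq: "\<beta> b = join h (\<alpha> b) (\<sigma> (z b) (shift h b))" if "b \<in> controls B" for b
      using that by (simp add: \<beta>_def)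
    have sh: "shift h b \<in> controls B" if "b \<in> controls B" for b
      by (rule shift_controls[OF h0 that])
    have \<beta>: "\<beta> \<in> strategies"
      unfolding nonanticipating_strategies_def
    proof (intro CollectI conjI allI impI ballI)
      show "\<beta> \<in> controls B \<rightarrow>\<^sub>E controls A"
        unfolding \<beta>_def by (auto intro!: join_controls h0 strategy_controls[OF \<alpha>] strategy_controls[OF \<sigma>] sh)
      fix t b1 b2 s
      assume t: "0 < t" and b12: "b1 \<in> controls B" "b2 \<in> controls B" and eq: "\<forall>s\<in>{0..t}. b1 s = b2 s"
        and s: "s \<in> {0..t}"
      have \<alpha>_eq: "\<alpha> b1 s = \<alpha> b2 s" if "0 \<le> s" "s \<le> t" for s
        by (rule strategy_cong[OF \<alpha> b12 t]) (use eq that in auto)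
      show "\<beta> b1 s = \<beta> b2 s"
      proof (cases "s \<le> h")
        case True
        then show ?thesis using \<alpha>_eq[of s] s b12 by (simp add: \<beta>_eq join_def)
      next
        case False
        \<comment> \<open>The common past up to \<open>h\<close> leads both replies to the same
          state, hence to the same continuation strategy, and \<open>t - h\<close> is positive as
          its nonanticipation demands.\<close>
        then have ht: "h < t" using s by simp
        have "z b1 = z b2"
          unfolding z_def
          by (rule trajectory_cong[where h=h])
             (use ht h \<alpha>_eq eq b12 in \<open>auto intro!: strategy_controls[OF \<alpha>]\<close>)
        moreover have "\<sigma> (z b1) (shift h b1) (s - h) = \<sigma> (z b1) (shift h b2) (s - h)"
          by (rule strategy_cong[OF \<sigma> sh sh, where t="t - h"])
             (use ht False s h eq b12 in \<open>auto simp: shift_def\<close>)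
        ultimately show ?thesis using False s b12 by (simp add: \<beta>_eq join_def)
      qed
    qed
    have "val ?q x0 - e \<le> val c x0"
    proof (rule val_geI[OF bnd_c \<beta>])
      fix b assume b: "b \<in> controls B"
      let ?a' = "\<sigma> (z b) (shift h b)"
      have eq: "\<beta> b s = \<alpha> b s" if "0 \<le> s" "s \<le> h" for s
        using that b by (simp add: \<beta>_eq join_def)
      have traj: "trajectory f x0 (\<beta> b) b s = trajectory f x0 (\<alpha> b) b s" if "0 \<le> s" "s \<le> h" for s
        by (rule trajectory_cong[where h=h])
           (use that eq in \<open>auto intro!: strategy_controls[OF \<alpha>] strategy_controls[OF \<beta>] b\<close>)
      have z_eq: "z b = trajectory f x0 (\<beta> b) b h"
        using traj[of h] h by (simp add: z_def)
      have "play r x0 (\<alpha> b) b = play r x0 (\<beta> b) b"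
        unfolding play_def by (rule local) (simp add: traj eq)
      moreover have "play c x0 (\<beta> b) b
          = play r x0 (\<beta> b) b + k * play c' (trajectory f x0 (\<beta> b) b h) ?a' (shift h b)"
      proof (rule split)
        show "?a' s = \<beta> b (h + s) \<and> shift h b s = b (h + s)" if "0 < s" for s
          using that h b by (auto simp: \<beta>_eq shift_def join_def)
      qed (auto intro!: strategy_controls[OF \<beta>] strategy_controls[OF \<sigma>] sh b)
      ultimately have c_eq: "play c x0 (\<beta> b) b = play r x0 (\<alpha> b) b + k * play c' (z b) ?a' (shift h b)"
        by (simp add: z_eq)
      have "val ?q x0 - e \<le> play ?q x0 (\<alpha> b) b - e / 2"
        using \<alpha>_ge[OF b] by simp
      also have "\<dots> \<le> play r x0 (\<alpha> b) b + k * (val c' (z b) - e / 2)"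
        using k_e[OF e2, of "val c' (z b)"] by (simp add: z_def play_q)
      also have "\<dots> \<le> play r x0 (\<alpha> b) b + k * play c' (z b) ?a' (shift h b)"
        using \<sigma>_ge[OF sh[OF b], of "z b"] k by (intro add_left_mono mult_left_mono) auto
      also have "\<dots> = play c x0 (\<beta> b) b" by (rule c_eq[symmetric])
      finally show "val ?q x0 - e \<le> play c x0 (\<beta> b) b" .
    qed
    then show "val ?q x0 \<le> val c x0 + e" by simp
  qed
qed

end

subsection \<open>Cesaro and Abel values\<close>

lemma set_integrable_exp_neg:
  assumes l: "0 < l"
  shows "set_integrable lborel {0..} (\<lambda>t::real. exp (- l * t))"
    and "(LINT t:{0::real..}|lborel. exp (- l * t)) = 1 / l"
proof -
  \<comment> \<open>Nonnegativity turns gauge integrability into Lebesgue integrability; Borel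
    measurability then brings it down to \<open>lborel\<close>.\<close>
  have "integrable lebesgue (\<lambda>t::real. indicat_real {0..} t *\<^sub>R exp (- l * t))"
    using l by (intro nonnegative_absolutely_integrable_1[unfolded set_integrable_def]
      integrable_on_exp_minus_to_infinity) auto
  moreover have "(\<lambda>t::real. indicat_real {0..} t *\<^sub>R exp (- l * t)) \<in> borel_measurable lborel"
    by measurable
  ultimately show int: "set_integrable lborel {0..} (\<lambda>t::real. exp (- l * t))"
    by (simp add: integrable_completion set_integrable_def)
  show "(LINT t:{0::real..}|lborel. exp (- l * t)) = 1 / l"
    using integral_unique[OF has_integral_exp_minus_to_infinity[OF l, of 0]]
    by (simp only: set_borel_integral_eq_integral(2)[OF int] mult_zero_right exp_zero)
qed

lemma set_integrable_const_Icc: "set_integrable lborel {a..b::real} (\<lambda>_. c::real)"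
  by (intro borel_integrable_atLeastAtMost' continuous_intros)

text \<open>Everything comes from \<open>1 + y \<le> exp y\<close>, taken at \<open>- y\<close> and
  at \<open>y\<close>. With \<open>y = l * h\<close> the first two bounds place
  \<open>\<mu> / h\<close> between \<open>l * (1 - \<mu>)\<close> and \<open>l\<close>.\<close>

lemma one_minus_exp_bounds:
  fixes y \<mu> :: real
  assumes "exp (- y) = 1 - \<mu>" "0 \<le> \<mu>" "\<mu> \<le> 1/2"
  shows "\<mu> \<le> y" "y * (1 - \<mu>) \<le> \<mu>" "y \<le> 2 * \<mu>"
proof -
  show "\<mu> \<le> y" using exp_ge_add_one_self[of "- y"] assms(1) by linarith
  have "(1 + y) * exp (- y) \<le> exp y * exp (- y)"
    by (intro mult_right_mono exp_ge_add_one_self) auto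
  also have "exp y * exp (- y) = 1" by (simp add: exp_minus)
  finally show *: "y * (1 - \<mu>) \<le> \<mu>"
    unfolding assms(1) by (simp add: algebra_simps)
  have "0 \<le> y" using \<open>\<mu> \<le> y\<close> assms by linarith
  then have "y * (1/2) \<le> y * (1 - \<mu>)" using assms by (intro mult_left_mono) auto
  then show "y \<le> 2 * \<mu>" using * by linarith
qed

lemma convex_unit:
  fixes u v \<mu> :: real
  assumes "0 \<le> u" "u \<le> 1" "0 \<le> v" "v \<le> 1" "0 \<le> \<mu>" "\<mu> \<le> 1"
  shows "\<bar>\<mu> * u + (1 - \<mu>) * v\<bar> \<le> 1"
proof -
  have "\<mu> * u \<le> \<mu>" "(1 - \<mu>) * v \<le> 1 - \<mu>" "0 \<le> \<mu> * u" "0 \<le> (1 - \<mu>) * v"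
    using assms by (auto intro!: mult_left_le)
  then show ?thesis by linarith
qed

section \<open>The game on an invariant set: payoffs with values in the unit interval\<close>

locale game = control_system f A B L
  for f :: "'x::euclidean_space \<Rightarrow> 'a::euclidean_space \<Rightarrow> 'b::euclidean_space \<Rightarrow> 'x"
    and A :: "'a set" and B :: "'b set" and L :: real +
  fixes g :: "'x \<Rightarrow> 'a \<Rightarrow> 'b \<Rightarrow> real" and X :: "'x set"
  assumes cont_g: "continuous_on (UNIV \<times> A \<times> B) (\<lambda>(x, a, b). g x a b)"
    and g_range: "\<And>x a b. a \<in> A \<Longrightarrow> b \<in> B \<Longrightarrow> g x a b \<in> {0..1}"
    and X_nonempty: "X \<noteq> {}" and invariant: "strongly_invariant f A B X"
begin

lemma trajectory_in_X:
  "x0 \<in> X \<Longrightarrow> a \<in> controls A \<Longrightarrow> b \<in> controls B \<Longrightarrow> 0 \<le> t \<Longrightarrow> trajectory f x0 a b t \<in> X"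
  using invariant by (fastforce simp: strongly_invariant_def trajectories_def)

text \<open>Common source of integrability and bounds for both means, with weight \<open>1\<close>
  on a bounded interval and an exponential weight on the half-line.\<close>

lemma weighted_payoff:
  assumes S: "S \<in> sets borel" "S \<subseteq> {0..}" and w: "set_integrable lborel S w" "\<And>t. t \<in> S \<Longrightarrow> 0 \<le> w t"
    and x: "continuous_on {0..} x" and a: "a \<in> controls A" "b \<in> controls B"
  shows "set_integrable lborel S (\<lambda>t. w t * g (x t) (a t) (b t))"
    and "0 \<le> (LINT t:S|lborel. w t * g (x t) (a t) (b t))"
    and "(LINT t:S|lborel. w t * g (x t) (a t) (b t)) \<le> (LINT t:S|lborel. w t)"
proof -
  have "(\<lambda>s. g (x s) (a s) (b s)) \<in> borel_measurable (restrict_space borel {0..})"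
    using measurable_along[OF cont_g x a] by simp
  then have [measurable]: "(\<lambda>s. indicator {0..} s *\<^sub>R g (x s) (a s) (b s)) \<in> borel_measurable borel"
    by (simp add: borel_measurable_restrict_space_iff)
  have [measurable]: "(\<lambda>t. indicator S t *\<^sub>R w t) \<in> borel_measurable borel"
    using borel_measurable_integrable[OF w(1)[unfolded set_integrable_def]] by simp
  have "(\<lambda>t. indicator S t *\<^sub>R (w t * g (x t) (a t) (b t)))
      = (\<lambda>t. (indicator S t *\<^sub>R w t) * (indicator {0..} t *\<^sub>R g (x t) (a t) (b t)))"
    using S by (intro ext) (auto split: split_indicator)
  also have "\<dots> \<in> borel_measurable borel" by measurable
  finally have meas: "set_borel_measurable lborel S (\<lambda>t. w t * g (x t) (a t) (b t))"
    by (simp add: set_borel_measurable_def)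
  have G: "0 \<le> w t * g (x t) (a t) (b t) \<and> w t * g (x t) (a t) (b t) \<le> w t" if "t \<in> S" for t
    using g_range[of "a t" "b t" "x t"] controls_in[OF a(1)] controls_in[OF a(2)] w(2)[OF that] that S
    by (auto intro!: mult_left_le)
  show int: "set_integrable lborel S (\<lambda>t. w t * g (x t) (a t) (b t))"
    using w(1) meas by (rule set_integrable_bound) (use G w(2) in \<open>force intro!: AE_I2\<close>)
  have "(LINT t:S|lborel. 0) \<le> (LINT t:S|lborel. w t * g (x t) (a t) (b t))"
    by (rule set_integral_mono[OF _ int]) (use G in \<open>auto simp: set_integrable_def\<close>)
  then show "0 \<le> (LINT t:S|lborel. w t * g (x t) (a t) (b t))" by simp
  show "(LINT t:S|lborel. w t * g (x t) (a t) (b t)) \<le> (LINT t:S|lborel. w t)"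
    by (rule set_integral_mono[OF int w(1)]) (use G in auto)
qed

lemmas unweighted_payoff = weighted_payoff[of "{0..T}" "\<lambda>_. 1" for T, simplified mult_1_left]

lemma cesaro_bounds:
  assumes "0 < T" "a \<in> controls A" "b \<in> controls B"
  shows "0 \<le> play (cesaro_payoff g T) x0 a b" "play (cesaro_payoff g T) x0 a b \<le> 1"
proof -
  have one: "set_integrable lborel {0..T} (\<lambda>_. 1::real)"
    by (rule set_integrable_const_Icc)
  have len: "(LINT t:{0..T}|lborel. (1::real)) = T"
    using assms by (simp add: set_lebesgue_integral_def)
  note * = unweighted_payoff[OF _ _ one _ continuous_on_trajectory[OF assms(2,3), of x0] assms(2,3)]
  show "0 \<le> play (cesaro_payoff g T) x0 a b"
    using *(2) assms by (simp add: play_def cesaro_payoff_def)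
  show "play (cesaro_payoff g T) x0 a b \<le> 1"
    using *(3) assms by (simp add: play_def cesaro_payoff_def len)
qed

lemma abel_bounds:
  assumes "0 < l" "a \<in> controls A" "b \<in> controls B"
  shows "0 \<le> play (abel_payoff g l) x0 a b" "play (abel_payoff g l) x0 a b \<le> 1"
proof -
  note * = weighted_payoff[OF _ _ set_integrable_exp_neg(1)[OF assms(1)] _
    continuous_on_trajectory[OF assms(2,3), of x0] assms(2,3)]
  show "0 \<le> play (abel_payoff g l) x0 a b"
    using *(2) assms by (simp add: play_def abel_payoff_def)
  have "l * (LINT t:{0..}|lborel. exp (- l * t) * g (trajectory f x0 a b t) (a t) (b t)) \<le> l * (1 / l)"
    using *(3) set_integrable_exp_neg(2)[OF assms(1)] assms(1) by (intro mult_left_mono) auto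
  then show "play (abel_payoff g l) x0 a b \<le> 1"
    using assms(1) by (simp add: play_def abel_payoff_def)
qed

lemma cesaro_bounded: "0 < T \<Longrightarrow> payoff_bounded (cesaro_payoff g T) x0 1"
  using cesaro_bounds[of T] by (intro payoff_boundedI) (auto simp: abs_le_iff intro: order_trans[of _ 0])

lemma abel_bounded: "0 < l \<Longrightarrow> payoff_bounded (abel_payoff g l) x0 1"
  using abel_bounds[of l] by (intro payoff_boundedI) (auto simp: abs_le_iff intro: order_trans[of _ 0])

lemma val_cesaro: "0 < T \<Longrightarrow> val (cesaro_payoff g T) x0 \<in> {0..1}"
  using val_between[of 0 "cesaro_payoff g T" x0 1] cesaro_bounds by simp

lemma val_abel: "0 < l \<Longrightarrow> val (abel_payoff g l) x0 \<in> {0..1}"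
  using val_between[of 0 "abel_payoff g l" x0 1] abel_bounds by simp

section \<open>One-stage games and the two recursions\<close>

text \<open>Its value is the operator \<open>P \<mu> \<phi>\<close> of the opening outline. Keeping
  \<open>\<mu>\<close> separate from \<open>h\<close> lets the Cesaro weight \<open>h / T\<close>
  and the Abel weight \<open>1 - exp (- (l * h))\<close> share one operator.\<close>

definition stage :: "real \<Rightarrow> real \<Rightarrow> ('x \<Rightarrow> real) \<Rightarrow> (real \<Rightarrow> 'x) \<Rightarrow> (real \<Rightarrow> 'a) \<Rightarrow> (real \<Rightarrow> 'b) \<Rightarrow> real"
  where "stage h \<mu> \<phi> = (\<lambda>x a b. \<mu> * cesaro_payoff g h x a b + (1 - \<mu>) * \<phi> (x h))"

lemma play_stage:
  "play (stage h \<mu> \<phi>) x0 a b = \<mu> * play (cesaro_payoff g h) x0 a b + (1 - \<mu>) * \<phi> (trajectory f x0 a b h)"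
  by (simp add: play_def stage_def)

lemma stage_bounded:
  assumes "0 < h" "0 \<le> \<mu>" "\<mu> \<le> 1" "x0 \<in> X" "\<phi> \<in> X \<rightarrow> {0..1}"
  shows "payoff_bounded (stage h \<mu> \<phi>) x0 1"
proof (rule payoff_boundedI)
  fix a b assume ab: "a \<in> controls A" "b \<in> controls B"
  have "\<phi> (trajectory f x0 a b h) \<in> {0..1}"
    using assms trajectory_in_X[OF assms(4) ab, of h] by (auto simp: Pi_iff)
  then show "\<bar>play (stage h \<mu> \<phi>) x0 a b\<bar> \<le> 1"
    unfolding play_stage using cesaro_bounds[OF assms(1) ab] assms(2,3) by (intro convex_unit) auto
qed

text \<open>Only the terminal terms differ, and strong invariance keeps the final state in
  \<open>X\<close>, where \<open>D\<close> applies.\<close>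

lemma stage_contraction:
  assumes h: "0 < h" and \<mu>: "0 \<le> \<mu>" "\<mu> \<le> 1" and x0: "x0 \<in> X"
    and \<phi>: "\<phi> \<in> X \<rightarrow> {0..1}" "\<psi> \<in> X \<rightarrow> {0..1}" and D: "\<And>x. x \<in> X \<Longrightarrow> \<bar>\<phi> x - \<psi> x\<bar> \<le> D"
  shows "\<bar>val (stage h \<mu> \<phi>) x0 - val (stage h \<mu> \<psi>) x0\<bar> \<le> (1 - \<mu>) * D"
proof (rule val_close[OF stage_bounded[OF h \<mu> x0 \<phi>(1)] stage_bounded[OF h \<mu> x0 \<phi>(2)]])
  fix a b assume ab: "a \<in> controls A" "b \<in> controls B"
  have "\<bar>(1 - \<mu>) * (\<phi> (trajectory f x0 a b h) - \<psi> (trajectory f x0 a b h))\<bar> \<le> (1 - \<mu>) * D"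
    unfolding abs_mult using D[OF trajectory_in_X[OF x0 ab, of h]] h \<mu> by (simp add: mult_left_mono)
  then show "\<bar>play (stage h \<mu> \<phi>) x0 a b - play (stage h \<mu> \<psi>) x0 a b\<bar> \<le> (1 - \<mu>) * D"
    by (simp add: play_stage right_diff_distrib)
qed

lemma cesaro_payoff_local:
  assumes "\<And>s. 0 \<le> s \<Longrightarrow> s \<le> h \<Longrightarrow> x s = x' s \<and> a s = a' s \<and> b s = b' s"
  shows "cesaro_payoff g h x a b = cesaro_payoff g h x' a' b'"
proof -
  have "(LINT t:{0..h}|lborel. g (x t) (a t) (b t)) = (LINT t:{0..h}|lborel. g (x' t) (a' t) (b' t))"
    by (rule set_lebesgue_integral_cong) (use assms in auto)
  then show ?thesis by (simp add: cesaro_payoff_def)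
qed

text \<open>The mean over a play of length \<open>T\<close> averages the means over its first
  \<open>h\<close> and its last \<open>T - h\<close> units of time, with weights
  \<open>h / T\<close> and \<open>1 - h / T\<close>.\<close>

lemma cesaro_recursion:
  assumes h: "0 < h" and T: "h < T"
  shows "val (cesaro_payoff g T) x0 = val (stage h (h / T) (val (cesaro_payoff g (T - h)))) x0"
  unfolding stage_def
proof (rule dynamic_programming[OF h])
  show "0 \<le> 1 - h / T" "1 - h / T \<le> 1" using h T by auto
  show "h / T * cesaro_payoff g h x a b = h / T * cesaro_payoff g h x' a' b'"
    if "\<And>s. 0 \<le> s \<Longrightarrow> s \<le> h \<Longrightarrow> x s = x' s \<and> a s = a' s \<and> b s = b' s" for x a b x' a' b'
    using cesaro_payoff_local[OF that] by simp
  show "payoff_bounded (cesaro_payoff g (T - h)) z 1" for z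
    using T by (intro cesaro_bounded) simp
  have play_r: "play (\<lambda>x a b. h / T * cesaro_payoff g h x a b) x0 a b = h / T * play (cesaro_payoff g h) x0 a b" for a b
    by (simp add: play_def)
  show "payoff_bounded (\<lambda>x a b. h / T * cesaro_payoff g h x a b) x0 (h / T * 1)"
  proof (rule payoff_boundedI)
    show "\<bar>play (\<lambda>x a b. h / T * cesaro_payoff g h x a b) x0 a b\<bar> \<le> h / T * 1"
      if "a \<in> controls A" "b \<in> controls B" for a b
      unfolding play_r abs_mult using payoff_boundedD[OF cesaro_bounded[OF h] that] h T
      by (intro mult_mono) auto
  qed
  fix a b a' b'
  assume ab: "a \<in> controls A" "b \<in> controls B" "a' \<in> controls A" "b' \<in> controls B"
    and sh: "\<And>s. 0 < s \<Longrightarrow> a' s = a (h + s) \<and> b' s = b (h + s)"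
  let ?x = "trajectory f x0 a b"
  let ?y = "trajectory f (?x h) a' b'"
  have one: "set_integrable lborel {0..T} (\<lambda>_. 1::real)"
    by (rule set_integrable_const_Icc)
  have "(LINT t:{0..T}|lborel. g (?x t) (a t) (b t)) = (LINT t:{0..h}|lborel. g (?x t) (a t) (b t))
      + (LINT t:{0..T-h}|lborel. g (?y t) (a' t) (b' t))"
  proof (rule set_integral_split_shift(2))
    show "set_integrable lborel {0..T} (\<lambda>t. g (?x t) (a t) (b t))"
      using unweighted_payoff(1)[OF _ _ one _ continuous_on_trajectory[OF ab(1,2), of x0] ab(1,2)] by simp
    show "g (?y s) (a' s) (b' s) = g (?x (h + s)) (a (h + s)) (b (h + s))" if "0 < s" for s
      using trajectory_shift[OF ab sh, of s] sh[OF that] h that by simp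
  qed (use h T in auto)
  then show "play (cesaro_payoff g T) x0 a b = play (\<lambda>x a b. h / T * cesaro_payoff g h x a b) x0 a b
      + (1 - h / T) * play (cesaro_payoff g (T - h)) (?x h) a' b'"
    using h T by (simp add: play_def cesaro_payoff_def field_simps)
qed

text \<open>Dynamic programming is exact for the discounted first stage \<open>r\<close>. On
  \<open>{0..h}\<close> its weight \<open>l * exp (- l * t)\<close> and the uniform weight
  \<open>\<mu> / h\<close> both lie between \<open>l * (1 - \<mu>)\<close> and \<open>l\<close>, so
  replacing one by the other costs at most
  \<open>l * h * \<mu> \<le> 2 * \<mu>\<^sup>2\<close>.\<close>

lemma abel_almost_fixed:
  assumes l: "0 < l" and h: "0 < h" and \<mu>: "0 < \<mu>" "\<mu> \<le> 1/2" and eq: "exp (- (l * h)) = 1 - \<mu>" and x0: "x0 \<in> X"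
  shows "\<bar>val (abel_payoff g l) x0 - val (stage h \<mu> (val (abel_payoff g l))) x0\<bar> \<le> 2 * \<mu>\<^sup>2"
proof -
  define r where "r = (\<lambda>x a b. l * (LINT t:{0..h}|lborel. exp (- l * t) * g (x t) (a t) (b t)))"
  let ?W = "val (abel_payoff g l)"
  let ?q = "\<lambda>x a b. r x a b + (1 - \<mu>) * ?W (x h)"
  have \<mu>_bounds: "\<mu> \<le> l * h" "l * h * (1 - \<mu>) \<le> \<mu>" "l * h \<le> 2 * \<mu>"
    using one_minus_exp_bounds[OF eq] \<mu> by auto
  have exp_int: "set_integrable lborel {0..h} (\<lambda>t. exp (- l * t))"
    by (intro borel_integrable_atLeastAtMost' continuous_intros)
  have one: "set_integrable lborel {0..h} (\<lambda>_. 1::real)"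
    by (rule set_integrable_const_Icc)
  have close: "\<bar>play r x0 a b - \<mu> * play (cesaro_payoff g h) x0 a b\<bar> \<le> 2 * \<mu>\<^sup>2"
    if ab: "a \<in> controls A" "b \<in> controls B" for a b
  proof -
    let ?G = "\<lambda>t. g (trajectory f x0 a b t) (a t) (b t)"
    have cont: "continuous_on {0..} (trajectory f x0 a b)"
      by (rule continuous_on_trajectory[OF ab])
    have i1: "set_integrable lborel {0..h} (\<lambda>t. exp (- l * t) * ?G t)"
      using weighted_payoff(1)[OF _ _ exp_int _ cont ab] by simp
    have i2: "set_integrable lborel {0..h} ?G"
      using unweighted_payoff(1)[OF _ _ one _ cont ab] by simp
    have "play r x0 a b - \<mu> * play (cesaro_payoff g h) x0 a b
        = (LINT t:{0..h}|lborel. l * (exp (- l * t) * ?G t)) - (LINT t:{0..h}|lborel. \<mu> / h * ?G t)"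
      by (simp add: play_def r_def cesaro_payoff_def)
    also have "\<dots> = (LINT t:{0..h}|lborel. l * (exp (- l * t) * ?G t) - \<mu> / h * ?G t)"
      by (rule set_integral_diff(2)[symmetric]) (use i1 i2 in auto)
    also have "norm \<dots> \<le> (LINT t:{0..h}|lborel. l * \<mu>)"
    proof (rule set_integral_norm_le)
      show "set_integrable lborel {0..h} (\<lambda>t. l * (exp (- l * t) * ?G t) - \<mu> / h * ?G t)"
        by (rule set_integral_diff(1)) (use i1 i2 in auto)
      show "set_integrable lborel {0..h} (\<lambda>t. l * \<mu>)"
        by (rule set_integrable_const_Icc)
      fix t assume t: "t \<in> {0..h}"
      have G: "0 \<le> ?G t" "?G t \<le> 1"
        using g_range[OF controls_in[OF ab(1)] controls_in[OF ab(2)], of t t] t by auto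
      have "exp (- (l * h)) \<le> exp (- l * t)" "exp (- l * t) \<le> 1"
        using t l by (auto simp: mult_left_mono)
      then have "l * (1 - \<mu>) \<le> l * exp (- l * t)" "l * exp (- l * t) \<le> l"
        using eq l by (auto intro!: mult_left_mono)
      moreover have "l * (1 - \<mu>) \<le> \<mu> / h" "\<mu> / h \<le> l"
        using \<mu>_bounds h by (auto simp: field_simps)
      ultimately have "\<bar>l * exp (- l * t) - \<mu> / h\<bar> \<le> l * \<mu>"
        by (simp add: algebra_simps abs_le_iff)
      then have "\<bar>l * exp (- l * t) - \<mu> / h\<bar> * ?G t \<le> l * \<mu> * 1"
        using G l \<mu> by (intro mult_mono) auto
      moreover have "l * (exp (- l * t) * ?G t) - \<mu> / h * ?G t = (l * exp (- l * t) - \<mu> / h) * ?G t"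
        by (simp add: algebra_simps)
      ultimately show "norm (l * (exp (- l * t) * ?G t) - \<mu> / h * ?G t) \<le> l * \<mu>"
        using G by (simp add: abs_mult)
    qed
    also have "\<dots> = (l * h) * \<mu>"
      using h by (simp add: set_lebesgue_integral_def)
    also have "\<dots> \<le> 2 * \<mu> * \<mu>"
      using \<mu>_bounds \<mu> by (intro mult_right_mono) auto
    finally show ?thesis by (simp add: power2_eq_square)
  qed
  have bnd_r: "payoff_bounded r x0 (1 + 2 * \<mu>\<^sup>2)"
  proof (rule payoff_boundedI)
    fix a b assume ab: "a \<in> controls A" "b \<in> controls B"
    have "\<mu> * play (cesaro_payoff g h) x0 a b \<le> 1 * 1"
      using cesaro_bounds[OF h ab, of x0] \<mu> by (intro mult_mono) auto
    moreover have "0 \<le> \<mu> * play (cesaro_payoff g h) x0 a b"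
      using cesaro_bounds[OF h ab, of x0] \<mu> by simp
    ultimately show "\<bar>play r x0 a b\<bar> \<le> 1 + 2 * \<mu>\<^sup>2"
      using close[OF ab] by linarith
  qed
  have W_range: "?W \<in> X \<rightarrow> {0..1}" using val_abel[OF l] by blast
  have dp: "?W x0 = val ?q x0"
  proof (rule dynamic_programming[OF h])
    show "0 \<le> 1 - \<mu>" "1 - \<mu> \<le> 1" using \<mu> by auto
    show "r x a b = r x' a' b'"
      if "\<And>s. 0 \<le> s \<Longrightarrow> s \<le> h \<Longrightarrow> x s = x' s \<and> a s = a' s \<and> b s = b' s" for x a b x' a' b'
    proof -
      have "(LINT t:{0..h}|lborel. exp (- l * t) * g (x t) (a t) (b t))
          = (LINT t:{0..h}|lborel. exp (- l * t) * g (x' t) (a' t) (b' t))"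
        by (rule set_lebesgue_integral_cong) (use that in auto)
      then show ?thesis by (simp add: r_def)
    qed
    show "payoff_bounded r x0 (1 + 2 * \<mu>\<^sup>2)" by (rule bnd_r)
    show "payoff_bounded (abel_payoff g l) z 1" for z by (rule abel_bounded[OF l])
    fix a b a' b'
    assume ab: "a \<in> controls A" "b \<in> controls B" "a' \<in> controls A" "b' \<in> controls B"
      and sh: "\<And>s. 0 < s \<Longrightarrow> a' s = a (h + s) \<and> b' s = b (h + s)"
    let ?x = "trajectory f x0 a b"
    let ?y = "trajectory f (?x h) a' b'"
    have "(LINT t:{0..}|lborel. exp (- l * t) * g (?x t) (a t) (b t))
        = (LINT t:{0..h}|lborel. exp (- l * t) * g (?x t) (a t) (b t))
        + (LINT t:{0..}|lborel. (1 - \<mu>) * (exp (- l * t) * g (?y t) (a' t) (b' t)))"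
    proof (rule set_integral_split_shift(2))
      show "set_integrable lborel {0..} (\<lambda>t. exp (- l * t) * g (?x t) (a t) (b t))"
        using weighted_payoff(1)[OF _ _ set_integrable_exp_neg(1)[OF l] _
          continuous_on_trajectory[OF ab(1,2), of x0] ab(1,2)] by simp
      show "(1 - \<mu>) * (exp (- l * s) * g (?y s) (a' s) (b' s))
          = exp (- l * (h + s)) * g (?x (h + s)) (a (h + s)) (b (h + s))" if "0 < s" for s
        using trajectory_shift[OF ab sh, of s] sh[OF that] h that
        by (simp add: eq[symmetric] distrib_left exp_add[symmetric] mult.assoc[symmetric])
    qed (use h in auto)
    then show "play (abel_payoff g l) x0 a b = play r x0 a b + (1 - \<mu>) * play (abel_payoff g l) (?x h) a' b'"
      by (simp add: play_def r_def abel_payoff_def distrib_left mult.left_commute)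
  qed
  show ?thesis
    unfolding dp
  proof (rule val_close)
    show "payoff_bounded (stage h \<mu> ?W) x0 1"
      using h \<mu> x0 W_range by (intro stage_bounded) auto
    have play_q: "play ?q x0 a b = play r x0 a b + (1 - \<mu>) * ?W (trajectory f x0 a b h)" for a b
      by (simp add: play_def)
    show "payoff_bounded ?q x0 (2 + 2 * \<mu>\<^sup>2)"
    proof (rule payoff_boundedI)
      fix a b assume ab: "a \<in> controls A" "b \<in> controls B"
      have "(1 - \<mu>) * ?W (trajectory f x0 a b h) \<le> 1 * 1"
        using val_abel[OF l, of "trajectory f x0 a b h"] \<mu> by (intro mult_mono) auto
      moreover have "0 \<le> (1 - \<mu>) * ?W (trajectory f x0 a b h)"
        using val_abel[OF l, of "trajectory f x0 a b h"] \<mu> by simp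
      ultimately show "\<bar>play ?q x0 a b\<bar> \<le> 2 + 2 * \<mu>\<^sup>2"
        using payoff_boundedD[OF bnd_r ab] unfolding play_q by linarith
    qed
    show "\<bar>play ?q x0 a b - play (stage h \<mu> ?W) x0 a b\<bar> \<le> 2 * \<mu>\<^sup>2"
      if "a \<in> controls A" "b \<in> controls B" for a b
      using close[OF that] by (simp add: play_q play_stage)
  qed
qed

section \<open>Transfer of uniform limits\<close>

text \<open>Applied to the supremum \<open>D\<close> of \<open>d\<close>, finite by the first
  hypothesis, the step gives \<open>D \<le> (1 - \<mu>) * D + \<kappa>\<close>, which is solved for
  \<open>D\<close> at once.\<close>

lemma contraction_bound:
  fixes d :: "'x \<Rightarrow> real"
  assumes d: "\<And>x. x \<in> X \<Longrightarrow> d x \<le> 1" and \<mu>: "0 < \<mu>"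
    and step: "\<And>D x. (\<And>y. y \<in> X \<Longrightarrow> d y \<le> D) \<Longrightarrow> x \<in> X \<Longrightarrow> d x \<le> (1 - \<mu>) * D + \<kappa>"
    and x: "x \<in> X"
  shows "d x \<le> \<kappa> / \<mu>"
proof -
  define D where "D = (SUP x\<in>X. d x)"
  have bdd: "bdd_above (d ` X)" using d by (rule bdd_aboveI2)
  have le: "d y \<le> D" if "y \<in> X" for y
    unfolding D_def using that bdd by (rule cSUP_upper)
  have "D \<le> (1 - \<mu>) * D + \<kappa>"
    unfolding D_def by (rule cSUP_least[OF X_nonempty]) (rule step[OF le, unfolded D_def])
  then have "D \<le> \<kappa> / \<mu>" using \<mu> by (simp add: field_simps)
  then show ?thesis using le[OF x] by linarith
qed

lemma abel_limit_if_cesaro_limit: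
  assumes U: "U \<in> X \<rightarrow> {0..1}"
    and lim: "uniform_limit X (\<lambda>T. val (cesaro_payoff g T)) U at_top"
  shows "uniform_limit X (\<lambda>l. val (abel_payoff g l)) U (at_right 0)"
proof (rule uniform_limitI)
  fix e :: real assume e: "0 < e"
  \<comment> \<open>This makes \<open>2 * \<mu> \<le> e / 4\<close>, the error that survives from
    \<open>abel_almost_fixed\<close>.\<close>
  obtain n :: nat where n: "max 2 (8 / e) < real n" using reals_Archimedean2 by blast
  define \<mu> where "\<mu> = 1 / real n"
  have n2: "2 < real n" "8 / e < real n" using n by auto
  have \<mu>: "0 < \<mu>" "\<mu> \<le> 1/2" "\<mu> \<le> e / 8"
    using n2 e by (auto simp: \<mu>_def field_simps)
  \<comment> \<open>Proportional to \<open>\<mu>\<close> because \<open>contraction_bound\<close>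
    divides by \<open>\<mu>\<close>; it contributes
    \<open>2 * \<epsilon> / \<mu> = e / 4\<close>.\<close>
  define \<epsilon> where "\<epsilon> = \<mu> * e / 8"
  have \<epsilon>: "0 < \<epsilon>" using \<mu> e by (simp add: \<epsilon>_def)
  obtain T0 where T0: "\<And>T x. T0 \<le> T \<Longrightarrow> x \<in> X \<Longrightarrow> dist (val (cesaro_payoff g T) x) (U x) < \<epsilon>"
    using uniform_limitD[OF lim \<epsilon>] unfolding eventually_at_top_linorder by blast
  define T1 where "T1 = max T0 1"
  \<comment> \<open>\<open>c\<close> is the product \<open>l * h\<close> for which one stage is
    discounted by exactly \<open>1 - \<mu>\<close>; with \<open>h = c / l\<close>, small
    \<open>l\<close> means long stages.\<close>
  define c where "c = - ln (1 - \<mu>)"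
  have c: "0 < c" using \<mu> by (simp add: c_def)
  show "\<forall>\<^sub>F l in at_right 0. \<forall>x\<in>X. dist (val (abel_payoff g l) x) (U x) < e"
    unfolding eventually_at_right_field
  proof (intro exI[of _ "c / T1"] conjI allI impI ballI)
    show "0 < c / T1" using c by (simp add: T1_def)
    fix l x assume l: "0 < l" "l < c / T1" and x: "x \<in> X"
    define h where "h = c / l"
    have T1: "0 < T1" by (simp add: T1_def)
    have "T1 < h" using l T1 by (simp add: h_def field_simps)
    then have h: "0 < h" "T0 \<le> h" "1 \<le> h" by (auto simp: T1_def)
    \<comment> \<open>With \<open>n\<close> stages the Cesaro weight \<open>h / T\<close> equals the
      Abel weight \<open>\<mu>\<close>, so both recursions use the same operator.\<close>
    define T where "T = real n * h"
    have "2 * h \<le> T" unfolding T_def using n2 h by (intro mult_right_mono) auto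
    then have T: "T0 \<le> T" "T0 \<le> T - h" "h < T" "0 < T - h" using h by auto
    have hT: "h / T = \<mu>" using h by (simp add: T_def \<mu>_def)
    have eq: "exp (- (l * h)) = 1 - \<mu>"
      using l \<mu> by (simp add: h_def c_def)
    let ?W = "val (abel_payoff g l)" and ?V = "val (cesaro_payoff g T)" and ?V' = "val (cesaro_payoff g (T - h))"
    have W: "?W \<in> X \<rightarrow> {0..1}" using val_abel[OF l(1)] by blast
    have V': "?V' \<in> X \<rightarrow> {0..1}" using val_cesaro[OF T(4)] by blast
    have "\<bar>?W x - U x\<bar> \<le> (2 * \<mu>\<^sup>2 + 2 * \<epsilon>) / \<mu>"
    proof (rule contraction_bound[OF _ \<mu>(1) _ x])
      show "\<bar>?W y - U y\<bar> \<le> 1" if "y \<in> X" for y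
      proof -
        have "?W y \<in> {0..1}" "U y \<in> {0..1}" using W U that by blast+
        then show ?thesis by (simp add: abs_le_iff)
      qed
      \<comment> \<open>The triangle inequality runs from \<open>?W\<close> through the stage values
        of \<open>?W\<close>, \<open>U\<close> and \<open>?V'\<close>, the last being
        \<open>?V\<close>, to \<open>U\<close>.\<close>
      fix D y assume D: "\<And>y. y \<in> X \<Longrightarrow> \<bar>?W y - U y\<bar> \<le> D" and y: "y \<in> X"
      have "\<bar>?W y - val (stage h \<mu> ?W) y\<bar> \<le> 2 * \<mu>\<^sup>2"
        by (rule abel_almost_fixed[OF l(1) h(1) \<mu>(1,2) eq y])
      moreover have "\<bar>val (stage h \<mu> ?W) y - val (stage h \<mu> U) y\<bar> \<le> (1 - \<mu>) * D"
        using \<mu> D by (intro stage_contraction h y W U) auto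
      moreover have "\<bar>val (stage h \<mu> U) y - val (stage h \<mu> ?V') y\<bar> \<le> (1 - \<mu>) * \<epsilon>"
        using \<mu> T0[OF T(2)] by (intro stage_contraction h y V' U) (auto simp: dist_real_def abs_minus_commute less_imp_le)
      moreover have "val (stage h \<mu> ?V') y = ?V y"
        using cesaro_recursion[OF h(1) T(3)] by (simp add: hT)
      moreover have "\<bar>?V y - U y\<bar> < \<epsilon>"
        using T0[OF T(1) y] by (simp add: dist_real_def)
      moreover have "(1 - \<mu>) * \<epsilon> \<le> \<epsilon>"
        using \<mu> \<epsilon> by (simp add: algebra_simps)
      ultimately show "\<bar>?W y - U y\<bar> \<le> (1 - \<mu>) * D + (2 * \<mu>\<^sup>2 + 2 * \<epsilon>)"
        by linarith
    qed
    also have "\<dots> = 2 * \<mu> + e / 4"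
      using \<mu>(1) by (simp add: \<epsilon>_def field_simps power2_eq_square)
    also have "\<dots> < e" using \<mu> e by linarith
    finally show "dist (?W x) (U x) < e" by (simp add: dist_real_def)
  qed
qed

text \<open>The Cesaro weight \<open>1 / j\<close> changes from stage to stage, so the error is
  scaled by \<open>j\<close>: as \<open>j * (1 - 1 / j) = j - 1\<close>, the inherited scaled error
  passes on unchanged and the scaled one-step errors just add up.\<close>

lemma cesaro_limit_if_abel_limit:
  assumes U: "U \<in> X \<rightarrow> {0..1}"
    and lim: "uniform_limit X (\<lambda>l. val (abel_payoff g l)) U (at_right 0)"
  shows "uniform_limit X (\<lambda>T. val (cesaro_payoff g T)) U at_top"
proof (rule uniform_limitI)
  fix e :: real assume e: "0 < e"
  \<comment> \<open>Chosen so that the accumulated error \<open>4 * sqrt n\<close>, divided by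
    \<open>n\<close>, stays below \<open>e / 4\<close>.\<close>
  obtain n :: nat where n: "max 1 ((16 / e)\<^sup>2) < real n" using reals_Archimedean2 by blast
  then have n1: "1 < real n" "0 < n" by auto
  have "16 / e < sqrt (real n)"
    using n by (intro real_less_rsqrt) simp
  then have sqrt_n: "4 / sqrt (real n) < e / 4"
    using e n1 by (simp add: field_simps)
  \<comment> \<open>The approximation errors accumulate to
    \<open>2 * n\<^sup>2 * \<epsilon>\<close>; divided by \<open>n\<close> this is
    \<open>e / 4\<close>.\<close>
  define \<epsilon> where "\<epsilon> = e / (8 * real n)"
  have \<epsilon>: "0 < \<epsilon>" using e n1 by (simp add: \<epsilon>_def)
  obtain l0 where l0: "0 < l0" "\<And>l x. 0 < l \<Longrightarrow> l < l0 \<Longrightarrow> x \<in> X \<Longrightarrow> dist (val (abel_payoff g l) x) (U x) < \<epsilon>"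
    using uniform_limitD[OF lim \<epsilon>] unfolding eventually_at_right_field by blast
  show "\<forall>\<^sub>F T in at_top. \<forall>x\<in>X. dist (val (cesaro_payoff g T) x) (U x) < e"
    unfolding eventually_at_top_dense
  proof (intro exI[of _ "real n / l0"] allI impI ballI)
    fix T x assume T: "real n / l0 < T" and x: "x \<in> X"
    define h where "h = T / real n"
    \<comment> \<open>Every discount rate in the induction is at most \<open>1 / h\<close>, so one
      lower bound on \<open>T\<close> makes all of them admissible.\<close>
    have h_gt: "1 / l0 < h"
      using T n1 l0 by (simp add: h_def field_simps)
    then have h: "0 < h" using l0 by (meson less_trans zero_less_divide_1_iff)
    \<comment> \<open>\<open>4 * sqrt k\<close> dominates the sum of the one-step errors \<open>2 / k\<close>.\<close>
    have bound: "real (Suc k) * \<bar>val (cesaro_payoff g (real (Suc k) * h)) y - U y\<bar>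
        \<le> 4 * sqrt (real (Suc k)) + 2 * (real (Suc k))\<^sup>2 * \<epsilon>" if "y \<in> X" for k y
      using that
    proof (induction k arbitrary: y)
      case 0
      have "val (cesaro_payoff g h) y \<in> {0..1}" "U y \<in> {0..1}"
        using val_cesaro[OF h] U 0 by auto
      then have "\<bar>val (cesaro_payoff g h) y - U y\<bar> \<le> 1" by (auto simp: abs_le_iff)
      then show ?case using \<epsilon> by simp
    next
      case (Suc k)
      define j where "j = real (Suc (Suc k))"
      have j: "2 \<le> j" "real (Suc k) = j - 1" by (auto simp: j_def)
      define \<mu> where "\<mu> = 1 / j"
      have \<mu>: "0 < \<mu>" "\<mu> \<le> 1/2" using j by (auto simp: \<mu>_def field_simps)
      \<comment> \<open>The stage length is fixed here, so each \<open>j\<close> gets its own rate,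
        the one whose discount over a stage is exactly \<open>1 - 1 / j\<close>.\<close>
      define l where "l = - ln (1 - \<mu>) / h"
      have "ln (1 - \<mu>) < 0" using \<mu> by simp
      then have l: "0 < l" using h by (simp add: l_def divide_neg_pos)
      have eq: "exp (- (l * h)) = 1 - \<mu>" using h \<mu> by (simp add: l_def)
      have "l * h \<le> 2 * \<mu>" using one_minus_exp_bounds(3)[OF eq] \<mu> by simp
      then have "l * h \<le> 1" using \<mu> by linarith
      then have "l \<le> 1 / h" using h by (simp add: field_simps)
      also have "\<dots> < l0" using h_gt h l0 by (simp add: field_simps)
      finally have "l < l0" .
      note W_close = l0(2)[OF l this]
      let ?W = "val (abel_payoff g l)" and ?V = "val (cesaro_payoff g (j * h))"
        and ?V' = "val (cesaro_payoff g (j * h - h))"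
      have jh: "h < j * h" "0 < j * h - h" "h / (j * h) = \<mu>" "j * h - h = (j - 1) * h"
        using j h by (auto simp: \<mu>_def algebra_simps)
      have W: "?W \<in> X \<rightarrow> {0..1}" using val_abel[OF l(1)] by blast
      have V': "?V' \<in> X \<rightarrow> {0..1}" using val_cesaro[OF jh(2)] by blast
      \<comment> \<open>The induction hypothesis, divided by \<open>j - 1\<close>.\<close>
      define D where "D = (4 * sqrt (j - 1) + 2 * (j - 1)\<^sup>2 * \<epsilon>) / (j - 1)"
      have D: "\<bar>?V' z - U z\<bar> \<le> D" if "z \<in> X" for z
        using Suc.IH[OF that] j(1) unfolding j(2) jh(4) D_def
        by (simp add: pos_le_divide_eq mult.commute[of "j - 1"])
      have y: "y \<in> X" by fact
      have "?V y = val (stage h \<mu> ?V') y"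
        using cesaro_recursion[OF h jh(1)] by (simp add: jh(3))
      moreover have "\<bar>val (stage h \<mu> ?V') y - val (stage h \<mu> U) y\<bar> \<le> (1 - \<mu>) * D"
        using \<mu> D by (intro stage_contraction h y V' U) auto
      moreover have "\<bar>val (stage h \<mu> U) y - val (stage h \<mu> ?W) y\<bar> \<le> (1 - \<mu>) * \<epsilon>"
        using \<mu> W_close by (intro stage_contraction h y W U) (auto simp: dist_real_def abs_minus_commute less_imp_le)
      moreover have "\<bar>?W y - val (stage h \<mu> ?W) y\<bar> \<le> 2 * \<mu>\<^sup>2"
        by (rule abel_almost_fixed[OF l h \<mu> eq y])
      moreover have "\<bar>?W y - U y\<bar> < \<epsilon>"
        using W_close[OF y] by (simp add: dist_real_def)
      moreover have "(1 - \<mu>) * \<epsilon> \<le> \<epsilon>"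
        using \<mu> \<epsilon> by (simp add: algebra_simps)
      ultimately have "\<bar>?V y - U y\<bar> \<le> (1 - \<mu>) * D + 2 * \<epsilon> + 2 * \<mu>\<^sup>2"
        by linarith
      then have "j * \<bar>?V y - U y\<bar> \<le> j * ((1 - \<mu>) * D + 2 * \<epsilon> + 2 * \<mu>\<^sup>2)"
        using j by (intro mult_left_mono) auto
      also have "\<dots> = (j - 1) * D + 2 * j * \<epsilon> + 2 / j"
        using j by (simp add: \<mu>_def field_simps power2_eq_square)
      also have "(j - 1) * D = 4 * sqrt (j - 1) + 2 * (j - 1)\<^sup>2 * \<epsilon>"
        using j by (simp add: D_def)
      \<comment> \<open>Weakening \<open>2 / j\<close> to \<open>2 / sqrt j\<close> is affordable
        and gives a telescoping bound, by rationalising the difference of the roots.\<close>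
      also have "2 / j \<le> 4 * (sqrt j - sqrt (j - 1))"
      proof -
        have "sqrt j \<le> j"
          using j by (intro real_le_lsqrt) (auto simp: power2_eq_square)
        then have "2 / j \<le> 2 / sqrt j"
          using j by (intro divide_left_mono) auto
        also have "\<dots> = 4 * (1 / (2 * sqrt j))" by simp
        also have "1 / (2 * sqrt j) \<le> sqrt j - sqrt (j - 1)"
        proof -
          have "sqrt (j - 1) \<le> sqrt j" by simp
          then have "(sqrt j - sqrt (j - 1)) * (sqrt j + sqrt (j - 1)) \<le> (sqrt j - sqrt (j - 1)) * (2 * sqrt j)"
            by (intro mult_left_mono) auto
          moreover have "(sqrt j - sqrt (j - 1)) * (sqrt j + sqrt (j - 1)) = 1"
            using j by (simp add: algebra_simps)
          ultimately show ?thesis using j by (simp add: field_simps)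
        qed
        finally show ?thesis by simp
      qed
      finally have "j * \<bar>?V y - U y\<bar> \<le> 4 * sqrt j + (2 * (j - 1)\<^sup>2 + 2 * j) * \<epsilon>"
        by (simp add: algebra_simps)
      also have "(2 * (j - 1)\<^sup>2 + 2 * j) * \<epsilon> \<le> 2 * j\<^sup>2 * \<epsilon>"
        using j \<epsilon> by (intro mult_right_mono) (auto simp: power2_eq_square algebra_simps)
      finally show ?case unfolding j_def[symmetric] by simp
    qed
    obtain k where k: "n = Suc k" using n1 by (cases n) auto
    have "real n * h = T" using n1 by (simp add: h_def)
    then have "real n * \<bar>val (cesaro_payoff g T) x - U x\<bar> \<le> 4 * sqrt (real n) + 2 * (real n)\<^sup>2 * \<epsilon>"
      using bound[OF x, of k] unfolding k[symmetric] by simp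
    then have "\<bar>val (cesaro_payoff g T) x - U x\<bar> \<le> (4 * sqrt (real n) + 2 * (real n)\<^sup>2 * \<epsilon>) / real n"
      using n1 by (simp add: field_simps)
    also have "\<dots> = 4 * (sqrt (real n) / real n) + e / 4"
      using n1 by (simp add: \<epsilon>_def power2_eq_square field_simps)
    also have "sqrt (real n) / real n = 1 / sqrt (real n)"
      using n1 by (simp add: field_simps)
    also have "4 * (1 / sqrt (real n)) + e / 4 < e" using sqrt_n e by simp
    finally show "dist (val (cesaro_payoff g T) x) (U x) < e" by (simp add: dist_real_def)
  qed
qed

end

theorem theorem4:
  fixes f :: "real ^ 'm \<Rightarrow> 'a::euclidean_space \<Rightarrow> 'b::euclidean_space \<Rightarrow> real ^ 'm"
    and g :: "real ^ 'm \<Rightarrow> 'a \<Rightarrow> 'b \<Rightarrow> real"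
    and A :: "'a set" and B :: "'b set" and X :: "(real ^ 'm) set"
    and U :: "real ^ 'm \<Rightarrow> real" and L :: real
  assumes "compact A" "A \<noteq> {}" "compact B" "B \<noteq> {}"
    and "continuous_on (UNIV \<times> A \<times> B) (\<lambda>(x, a, b). f x a b)"
    and "continuous_on (UNIV \<times> A \<times> B) (\<lambda>(x, a, b). g x a b)"
    and "\<And>x a b. a \<in> A \<Longrightarrow> b \<in> B \<Longrightarrow> g x a b \<in> {0..1}"
    and "L > 0"
    and "\<And>x y a b. a \<in> A \<Longrightarrow> b \<in> B \<Longrightarrow>
           norm (f x a b - f y a b) + \<bar>g x a b - g y a b\<bar> \<le> L * norm (x - y)"
    and "X \<noteq> {}" "strongly_invariant f A B X"
    and "U \<in> X \<rightarrow> {0..1}"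
  shows "uniform_limit X (\<lambda>T. lower_value f A B (cesaro_payoff g T)) U at_top \<longleftrightarrow>
         uniform_limit X (\<lambda>l. lower_value f A B (abel_payoff g l)) U (at_right 0)"
proof -
  have "norm (f x a b - f y a b) \<le> L * norm (x - y)" if "a \<in> A" "b \<in> B" for x y a b
    using assms(9)[OF that, of x y] by linarith
  then interpret game f A B L g X
    by unfold_locales (use assms in auto)
  show ?thesis
    using abel_limit_if_cesaro_limit cesaro_limit_if_abel_limit assms(12) by blast
qed

end
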